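(* Let $S$ and $T$ be 2-monads on a 2-category $\mathcal C$, and let $\lambda\colon ST\Rightarrow TS$ be a 2-categorical distributive law. Let $(a_t\colon TA\to A,\ a_s\colon SA\to A)$ and $(b_t\colon TB\to B,\ b_s\colon SB\to B)$ be $\lambda$-distributive pairs, regarded as $TS$-algebras. Then a weak map of $TS$-algebras $$(a_t,a_s)\longrightarrow(b_t,b_s)$$ is (equivalently) given by a 1-cell $f\colon A\to B$ together with invertible 2-cells $$\tau\colon b_t\circ Tf\Rightarrow f\circ a_t,\qquad \sigma\colon b_s\circ Sf\Rightarrow f\circ a_s$$ such that $(f,\tau)$ is a weak map of $T$-algebras $a_t\to b_t$, $(f,\sigma)$ is a weak map of $S$-algebras $a_s\to b_s$, and the following interaction axiom holds: $$\big(\tau * (Ta_s\circ\lambda_A)\big)\circ\big(b_t * T\sigma * \lambda_A\big)\;=\;\big(\sigma * Sa_t\big)\circ\big(b_s * S\tau\big),$$ as 2-cells from $b_t\circ Tb_s\circ\lambda_B\circ STf=b_s\circ Sb_t\circ STf$ to $f\circ a_t\circ Ta_s\circ\lambda_A=f\circ a_s\circ Sa_t$ (here naturality $\lambda_B\circ STf=TSf\circ\lambda_A$ is used on the left).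
   Context: Everything is strict except maps of algebras: $\mathcal C$ is a strict 2-category, $S,T$ are strict 2-monads (2-functors with 2-natural unit $\eta$ and multiplication $\mu$), and a 2-categorical distributive law of $S$ over $T$ is a 2-natural transformation $\lambda\colon ST\Rightarrow TS$ satisfying Beck's four axioms (compatibility with $\eta^S,\mu^S,\eta^T,\mu^T$) on the nose. Then $TS$ is a 2-monad with multiplication $\mu^T\mu^S\circ T\lambda S$ and unit $\eta^T\eta^S$. Algebras are strict. A $\lambda$-distributive pair on an object $A$ is a $T$-algebra $a_t\colon TA\to A$ and an $S$-algebra $a_s\colon SA\to A$ with $a_s\circ Sa_t=a_t\circ Ta_s\circ\lambda_A$. By Beck's theorem these are the same thing as $TS$-algebras: the pair corresponds to the $TS$-algebra $a_t\circ Ta_s\colon TSA\to A$, and a $TS$-algebra $\theta$ corresponds to the pair $a_t=\theta\circ T\eta^S_A$, $a_s=\theta\circ\eta^T_{SA}$. For a 2-monad $R$ and strict $R$-algebras $a\colon RA\to A$, $b\colon RB\to B$, a weak map is a 1-cell $f\colon A\to B$ with an invertible 2-cell $\rho\colon b\circ Rf\Rightarrow f\circ a$ such that $(\rho*Ra)\circ(b*R\rho)=\rho*\mu_A$ and $\rho*\eta_A=1_f$. Here $*$ denotes whiskering and $\circ$ denotes vertical composition of 2-cells or composition of 1-cells. *)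

theory Defs
  imports Main
begin

section \<open>Strict 2-categories\<close>

text \<open>
  0-cells, 1-cells and 2-cells are the elements of three carrier sets. Every 1-cell has a unique
  domain and codomain, every 2-cell a unique source and target 1-cell. Compositions are total
  functions that are constrained only on composable cells of the carriers, and are written in
  applicative order: \<open>g \<odot> f\<close> and \<open>\<beta> \<bullet> \<alpha>\<close> mean \<open>g\<close> after \<open>f\<close> and \<open>\<beta>\<close> after \<open>\<alpha>\<close>.
\<close>

record ('o, 'm, 'c) two_cat_data =
  Obj :: "'o set"
  Arr :: "'m set"
  Cell :: "'c set"
  dom1 :: "'m \<Rightarrow> 'o"
  cod1 :: "'m \<Rightarrow> 'o"
  src2 :: "'c \<Rightarrow> 'm"
  tgt2 :: "'c \<Rightarrow> 'm"
  one1 :: "'o \<Rightarrow> 'm"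
  comp1 :: "'m \<Rightarrow> 'm \<Rightarrow> 'm"  (infixr "\<odot>\<index>" 75)
  one2 :: "'m \<Rightarrow> 'c"
  vcomp :: "'c \<Rightarrow> 'c \<Rightarrow> 'c"  (infixr "\<bullet>\<index>" 65)
  hcomp :: "'c \<Rightarrow> 'c \<Rightarrow> 'c"  (infixr "\<star>\<index>" 70)

definition in_hom1 :: "('o, 'm, 'c, 'z) two_cat_data_scheme \<Rightarrow> 'm \<Rightarrow> 'o \<Rightarrow> 'o \<Rightarrow> bool"
    ("(\<open>notation=\<open>mixfix in_hom1\<close>\<close>_ :\<index> _ \<rightarrow> _)" [60, 60, 60] 50)
  where "f :\<^bsub>C\<^esub> A \<rightarrow> B \<longleftrightarrow> f \<in> Arr C \<and> dom1 C f = A \<and> cod1 C f = B"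

definition in_hom2 :: "('o, 'm, 'c, 'z) two_cat_data_scheme \<Rightarrow> 'c \<Rightarrow> 'm \<Rightarrow> 'm \<Rightarrow> bool"
    ("(\<open>notation=\<open>mixfix in_hom2\<close>\<close>_ :\<index> _ \<rightharpoonup> _)" [60, 60, 60] 50)
  where "\<alpha> :\<^bsub>C\<^esub> f \<rightharpoonup> g \<longleftrightarrow> \<alpha> \<in> Cell C \<and> src2 C \<alpha> = f \<and> tgt2 C \<alpha> = g"

definition lwhisker :: "('o, 'm, 'c, 'z) two_cat_data_scheme \<Rightarrow> 'm \<Rightarrow> 'c \<Rightarrow> 'c"  (infixr "\<rhd>\<index>" 70)
  where "g \<rhd>\<^bsub>C\<^esub> \<alpha> = one2 C g \<star>\<^bsub>C\<^esub> \<alpha>"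

definition rwhisker :: "('o, 'm, 'c, 'z) two_cat_data_scheme \<Rightarrow> 'c \<Rightarrow> 'm \<Rightarrow> 'c"  (infixl "\<lhd>\<index>" 71)
  where "\<alpha> \<lhd>\<^bsub>C\<^esub> f = \<alpha> \<star>\<^bsub>C\<^esub> one2 C f"

definition invertible2 :: "('o, 'm, 'c, 'z) two_cat_data_scheme \<Rightarrow> 'c \<Rightarrow> bool"
  where "invertible2 C \<alpha> \<longleftrightarrow> \<alpha> \<in> Cell C \<and>
    (\<exists>\<beta>. \<beta> :\<^bsub>C\<^esub> tgt2 C \<alpha> \<rightharpoonup> src2 C \<alpha> \<and>
      \<beta> \<bullet>\<^bsub>C\<^esub> \<alpha> = one2 C (src2 C \<alpha>) \<and> \<alpha> \<bullet>\<^bsub>C\<^esub> \<beta> = one2 C (tgt2 C \<alpha>))"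

locale two_category =
  fixes C :: "('o, 'm, 'c, 'z) two_cat_data_scheme" (structure)
  assumes dom1_Obj: "f \<in> Arr C \<Longrightarrow> dom1 C f \<in> Obj C"
    and cod1_Obj: "f \<in> Arr C \<Longrightarrow> cod1 C f \<in> Obj C"
    and src2_Arr: "\<alpha> \<in> Cell C \<Longrightarrow> src2 C \<alpha> \<in> Arr C"
    and tgt2_Arr: "\<alpha> \<in> Cell C \<Longrightarrow> tgt2 C \<alpha> \<in> Arr C"
    and parallel_dom: "\<alpha> \<in> Cell C \<Longrightarrow> dom1 C (src2 C \<alpha>) = dom1 C (tgt2 C \<alpha>)"
    and parallel_cod: "\<alpha> \<in> Cell C \<Longrightarrow> cod1 C (src2 C \<alpha>) = cod1 C (tgt2 C \<alpha>)"
    and one1_hom: "X \<in> Obj C \<Longrightarrow> one1 C X : X \<rightarrow> X"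
    and comp1_hom: "\<lbrakk>f : X \<rightarrow> Y; g : Y \<rightarrow> Z\<rbrakk> \<Longrightarrow> g \<odot> f : X \<rightarrow> Z"
    and comp1_one_left: "f : X \<rightarrow> Y \<Longrightarrow> one1 C Y \<odot> f = f"
    and comp1_one_right: "f : X \<rightarrow> Y \<Longrightarrow> f \<odot> one1 C X = f"
    and comp1_assoc: "\<lbrakk>f : W \<rightarrow> X; g : X \<rightarrow> Y; h : Y \<rightarrow> Z\<rbrakk> \<Longrightarrow> (h \<odot> g) \<odot> f = h \<odot> (g \<odot> f)"
    and one2_hom: "f \<in> Arr C \<Longrightarrow> one2 C f : f \<rightharpoonup> f"
    and vcomp_hom: "\<lbrakk>\<alpha> : f \<rightharpoonup> g; \<beta> : g \<rightharpoonup> h\<rbrakk> \<Longrightarrow> \<beta> \<bullet> \<alpha> : f \<rightharpoonup> h"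
    and vcomp_one_left: "\<alpha> : f \<rightharpoonup> g \<Longrightarrow> one2 C g \<bullet> \<alpha> = \<alpha>"
    and vcomp_one_right: "\<alpha> : f \<rightharpoonup> g \<Longrightarrow> \<alpha> \<bullet> one2 C f = \<alpha>"
    and vcomp_assoc: "\<lbrakk>\<alpha> : f \<rightharpoonup> g; \<beta> : g \<rightharpoonup> h; \<gamma> : h \<rightharpoonup> k\<rbrakk> \<Longrightarrow> (\<gamma> \<bullet> \<beta>) \<bullet> \<alpha> = \<gamma> \<bullet> (\<beta> \<bullet> \<alpha>)"
    and hcomp_hom: "\<lbrakk>\<alpha> : f \<rightharpoonup> f'; f : X \<rightarrow> Y; \<beta> : g \<rightharpoonup> g'; g : Y \<rightarrow> Z\<rbrakk>
      \<Longrightarrow> \<beta> \<star> \<alpha> : g \<odot> f \<rightharpoonup> g' \<odot> f'"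
    and hcomp_one_left: "\<lbrakk>\<alpha> : f \<rightharpoonup> g; f : X \<rightarrow> Y\<rbrakk> \<Longrightarrow> one2 C (one1 C Y) \<star> \<alpha> = \<alpha>"
    and hcomp_one_right: "\<lbrakk>\<alpha> : f \<rightharpoonup> g; f : X \<rightarrow> Y\<rbrakk> \<Longrightarrow> \<alpha> \<star> one2 C (one1 C X) = \<alpha>"
    and hcomp_assoc: "\<lbrakk>\<alpha> : f \<rightharpoonup> f'; f : W \<rightarrow> X; \<beta> : g \<rightharpoonup> g'; g : X \<rightarrow> Y; \<gamma> : h \<rightharpoonup> h'; h : Y \<rightarrow> Z\<rbrakk>
      \<Longrightarrow> (\<gamma> \<star> \<beta>) \<star> \<alpha> = \<gamma> \<star> (\<beta> \<star> \<alpha>)"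
    and hcomp_one2: "\<lbrakk>f : X \<rightarrow> Y; g : Y \<rightarrow> Z\<rbrakk> \<Longrightarrow> one2 C g \<star> one2 C f = one2 C (g \<odot> f)"
    and interchange: "\<lbrakk>\<alpha> : f \<rightharpoonup> f'; \<alpha>' : f' \<rightharpoonup> f''; f : X \<rightarrow> Y; \<beta> : g \<rightharpoonup> g'; \<beta>' : g' \<rightharpoonup> g''; g : Y \<rightarrow> Z\<rbrakk>
      \<Longrightarrow> (\<beta>' \<bullet> \<beta>) \<star> (\<alpha>' \<bullet> \<alpha>) = (\<beta>' \<star> \<alpha>') \<bullet> (\<beta> \<star> \<alpha>)"


section \<open>Strict 2-functors, 2-natural transformations and 2-monads\<close>

text \<open>Only endo-2-functors of one 2-category are needed.\<close>

record ('o, 'm, 'c) two_functor_data =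
  on0 :: "'o \<Rightarrow> 'o"
  on1 :: "'m \<Rightarrow> 'm"
  on2 :: "'c \<Rightarrow> 'c"

record ('o, 'm, 'c) two_monad_data = "('o, 'm, 'c) two_functor_data" +
  unit :: "'o \<Rightarrow> 'm"
  mult :: "'o \<Rightarrow> 'm"

locale two_functor = two_category C
  for C :: "('o, 'm, 'c, 'z) two_cat_data_scheme" (structure)
    and F :: "('o, 'm, 'c, 'y) two_functor_data_scheme" +
  assumes on0_Obj: "X \<in> Obj C \<Longrightarrow> on0 F X \<in> Obj C"
    and on1_hom: "f : X \<rightarrow> Y \<Longrightarrow> on1 F f : on0 F X \<rightarrow> on0 F Y"
    and on2_hom: "\<alpha> : f \<rightharpoonup> g \<Longrightarrow> on2 F \<alpha> : on1 F f \<rightharpoonup> on1 F g"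
    and on1_one1: "X \<in> Obj C \<Longrightarrow> on1 F (one1 C X) = one1 C (on0 F X)"
    and on1_comp1: "\<lbrakk>f : X \<rightarrow> Y; g : Y \<rightarrow> Z\<rbrakk> \<Longrightarrow> on1 F (g \<odot> f) = on1 F g \<odot> on1 F f"
    and on2_one2: "f \<in> Arr C \<Longrightarrow> on2 F (one2 C f) = one2 C (on1 F f)"
    and on2_vcomp: "\<lbrakk>\<alpha> : f \<rightharpoonup> g; \<beta> : g \<rightharpoonup> h\<rbrakk> \<Longrightarrow> on2 F (\<beta> \<bullet> \<alpha>) = on2 F \<beta> \<bullet> on2 F \<alpha>"
    and on2_hcomp: "\<lbrakk>\<alpha> : f \<rightharpoonup> f'; f : X \<rightarrow> Y; \<beta> : g \<rightharpoonup> g'; g : Y \<rightarrow> Z\<rbrakk>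
      \<Longrightarrow> on2 F (\<beta> \<star> \<alpha>) = on2 F \<beta> \<star> on2 F \<alpha>"

definition id_functor :: "('o, 'm, 'c) two_functor_data"
  where "id_functor = \<lparr>on0 = (\<lambda>X. X), on1 = (\<lambda>f. f), on2 = (\<lambda>\<alpha>. \<alpha>)\<rparr>"

definition comp_functor ::
    "('o, 'm, 'c, 'y) two_functor_data_scheme \<Rightarrow> ('o, 'm, 'c, 'z) two_functor_data_scheme
      \<Rightarrow> ('o, 'm, 'c) two_functor_data"  (infixr "\<circ>\<^sub>F" 75)
  where "G \<circ>\<^sub>F F = \<lparr>on0 = on0 G \<circ> on0 F, on1 = on1 G \<circ> on1 F, on2 = on2 G \<circ> on2 F\<rparr>"

locale two_natural = dom: two_functor C F + cod: two_functor C G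
  for C :: "('o, 'm, 'c, 'z) two_cat_data_scheme" (structure)
    and F :: "('o, 'm, 'c, 'x) two_functor_data_scheme"
    and G :: "('o, 'm, 'c, 'y) two_functor_data_scheme" +
  fixes \<theta> :: "'o \<Rightarrow> 'm"
  assumes component: "X \<in> Obj C \<Longrightarrow> \<theta> X : on0 F X \<rightarrow> on0 G X"
    and natural1: "f : X \<rightarrow> Y \<Longrightarrow> \<theta> Y \<odot> on1 F f = on1 G f \<odot> \<theta> X"
    and natural2: "\<lbrakk>\<alpha> : f \<rightharpoonup> g; f : X \<rightarrow> Y\<rbrakk> \<Longrightarrow> \<theta> Y \<rhd> on2 F \<alpha> = on2 G \<alpha> \<lhd> \<theta> X"

locale two_monad = two_functor C R +
    unit: two_natural C id_functor R "unit R" +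
    mult: two_natural C "R \<circ>\<^sub>F R" R "mult R"
  for C :: "('o, 'm, 'c, 'z) two_cat_data_scheme" (structure)
    and R :: "('o, 'm, 'c, 'y) two_monad_data_scheme" +
  assumes mult_assoc: "X \<in> Obj C \<Longrightarrow>
      mult R X \<odot> on1 R (mult R X) = mult R X \<odot> mult R (on0 R X)"
    and mult_unit_inner: "X \<in> Obj C \<Longrightarrow> mult R X \<odot> on1 R (unit R X) = one1 C (on0 R X)"
    and mult_unit_outer: "X \<in> Obj C \<Longrightarrow> mult R X \<odot> unit R (on0 R X) = one1 C (on0 R X)"


section \<open>Strict algebras and weak maps\<close>

locale strict_algebra = two_monad C R
  for C :: "('o, 'm, 'c, 'z) two_cat_data_scheme" (structure)
    and R :: "('o, 'm, 'c, 'y) two_monad_data_scheme" +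
  fixes A :: 'o and a :: 'm
  assumes carrier: "A \<in> Obj C"
    and action: "a : on0 R A \<rightarrow> A"
    and action_mult: "a \<odot> on1 R a = a \<odot> mult R A"
    and action_unit: "a \<odot> unit R A = one1 C A"

locale weak_map = dom: strict_algebra C R A a + cod: strict_algebra C R B b
  for C :: "('o, 'm, 'c, 'z) two_cat_data_scheme" (structure)
    and R :: "('o, 'm, 'c, 'y) two_monad_data_scheme"
    and A :: 'o and a :: 'm and B :: 'o and b :: 'm +
  fixes f :: 'm and \<rho> :: 'c
  assumes arrow: "f : A \<rightarrow> B"
    and cell: "\<rho> : b \<odot> on1 R f \<rightharpoonup> f \<odot> a"
    and invertible: "invertible2 C \<rho>"
    and cell_mult: "(\<rho> \<lhd> on1 R a) \<bullet> (b \<rhd> on2 R \<rho>) = \<rho> \<lhd> mult R A"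
    and cell_unit: "\<rho> \<lhd> unit R A = one2 C f"


section \<open>Distributive laws\<close>

locale distributive_law = S: two_monad C S + T: two_monad C T +
    law: two_natural C "S \<circ>\<^sub>F T" "T \<circ>\<^sub>F S" \<Lambda>
  for C :: "('o, 'm, 'c, 'z) two_cat_data_scheme" (structure)
    and S :: "('o, 'm, 'c, 'x) two_monad_data_scheme"
    and T :: "('o, 'm, 'c, 'y) two_monad_data_scheme"
    and \<Lambda> :: "'o \<Rightarrow> 'm" +
  assumes law_unit_S: "X \<in> Obj C \<Longrightarrow> \<Lambda> X \<odot> unit S (on0 T X) = on1 T (unit S X)"
    and law_unit_T: "X \<in> Obj C \<Longrightarrow> \<Lambda> X \<odot> on1 S (unit T X) = unit T (on0 S X)"
    and law_mult_S: "X \<in> Obj C \<Longrightarrow>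
      \<Lambda> X \<odot> mult S (on0 T X) = on1 T (mult S X) \<odot> \<Lambda> (on0 S X) \<odot> on1 S (\<Lambda> X)"
    and law_mult_T: "X \<in> Obj C \<Longrightarrow>
      \<Lambda> X \<odot> on1 S (mult T X) = mult T (on0 S X) \<odot> on1 T (\<Lambda> X) \<odot> \<Lambda> (on0 T X)"

text \<open>
  The component at \<open>X\<close> of the horizontal composite of the two multiplications is
  \<open>mult T (S X) \<odot> T (T (mult S X))\<close>, and that of the two units is \<open>unit T (S X) \<odot> unit S X\<close>.
\<close>

definition composite_monad ::
    "('o, 'm, 'c, 'z) two_cat_data_scheme \<Rightarrow> ('o, 'm, 'c, 'x) two_monad_data_scheme
      \<Rightarrow> ('o, 'm, 'c, 'y) two_monad_data_scheme \<Rightarrow> ('o \<Rightarrow> 'm) \<Rightarrow> ('o, 'm, 'c) two_monad_data"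
  where "composite_monad C S T \<Lambda> =
    \<lparr>on0 = on0 T \<circ> on0 S, on1 = on1 T \<circ> on1 S, on2 = on2 T \<circ> on2 S,
     unit = (\<lambda>X. unit T (on0 S X) \<odot>\<^bsub>C\<^esub> unit S X),
     mult = (\<lambda>X. (mult T (on0 S X) \<odot>\<^bsub>C\<^esub> on1 T (on1 T (mult S X))) \<odot>\<^bsub>C\<^esub> on1 T (\<Lambda> (on0 S X)))\<rparr>"

locale distributive_pair = distributive_law C S T \<Lambda> +
    T_alg: strict_algebra C T A a\<^sub>t + S_alg: strict_algebra C S A a\<^sub>s
  for C :: "('o, 'm, 'c, 'z) two_cat_data_scheme" (structure)
    and S :: "('o, 'm, 'c, 'x) two_monad_data_scheme"
    and T :: "('o, 'm, 'c, 'y) two_monad_data_scheme"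
    and \<Lambda> :: "'o \<Rightarrow> 'm" and A :: 'o and a\<^sub>t :: 'm and a\<^sub>s :: 'm +
  assumes pair_compatible: "a\<^sub>s \<odot> on1 S a\<^sub>t = a\<^sub>t \<odot> on1 T a\<^sub>s \<odot> \<Lambda> A"

end

theory Submission
  imports Defs
begin

text \<open>
  A weak map of \<open>R\<close>-algebras is itself a strict algebra, in another 2-category. Take the 1-cells
  \<open>f : A \<rightarrow> B\<close> of \<open>C\<close> as objects and, as morphisms from \<open>f\<close> to \<open>g\<close>, the squares consisting of 1-cells
  \<open>u\<close> and \<open>v\<close> between the domains and the codomains and a 2-cell \<open>v \<odot> f \<rightharpoonup> g \<odot> u\<close>, composed by
  pasting. A 2-monad \<open>R\<close> on \<open>C\<close> acts on squares, and its unit and multiplication become squares filled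
  with identities; these are natural because of the 2-dimensional part of 2-naturality. An action
  of the lifted monad on \<open>f\<close> is a square with edges \<open>a\<close> and \<open>b\<close> filled with a 2-cell
  \<open>\<rho> : b \<odot> on1 R f \<rightharpoonup> f \<odot> a\<close>, and the axioms of a strict algebra say that \<open>a\<close> and \<open>b\<close> are strict
  algebras and that \<open>\<rho>\<close> satisfies the two axioms of a weak map
  (\<open>weak_map_iff_strict_algebra\<close>).

  A distributive law lifts to squares as well (\<open>sq_distributive_law\<close>). The theorem is then Beck's
  theorem for the lifted law: an algebra of the composite monad on \<open>f\<close> is the same as a distributive
  pair on \<open>f\<close>, and the compatibility condition of such a pair, read on 2-cells, is the interaction
  axiom (\<open>distributive_pair_squares_iff\<close>). The formulas \<open>\<tau> = \<rho> \<lhd> on1 T (unit S A)\<close>,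
  \<open>\<sigma> = \<rho> \<lhd> unit T (on0 S A)\<close> and \<open>\<rho> = (\<tau> \<lhd> on1 T a\<^sub>s) \<bullet> (b\<^sub>t \<rhd> on2 T \<sigma>)\<close> are the 2-cells of Beck's
  formulas \<open>h \<odot> on1 T (unit S A)\<close>, \<open>h \<odot> unit T (on0 S A)\<close> and \<open>a\<^sub>t \<odot> on1 T a\<^sub>s\<close>. Invertibility carries
  over in both directions since whiskering, 2-functors and vertical composition preserve it.

  Beck's theorem (\<open>composite_two_monad\<close>, \<open>composite_strict_algebra\<close>,
  \<open>composite_algebra_components\<close>) is proved for an arbitrary strict 2-category and is used twice, for
  \<open>C\<close>, where it makes \<open>a\<^sub>t \<odot> on1 T a\<^sub>s\<close> an algebra, and for the squares in \<open>C\<close>.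
\<close>


section \<open>Calculating with composable cells\<close>

text \<open>
  Composability is a side condition of every equation of a 2-category. Here the axioms are
  restated with conditions on \<open>dom1\<close>, \<open>cod1\<close>, \<open>src2\<close> and \<open>tgt2\<close> alone, which rewriting can
  discharge from the rules that compute these for composites; the axioms in terms of hom-sets
  mention intermediate 0-cells and 1-cells that rewriting would have to guess.
\<close>

context two_category
begin

lemma dom1_Obj' [simp]: "f \<in> Arr C \<Longrightarrow> dom1 C f \<in> Obj C"
  and cod1_Obj' [simp]: "f \<in> Arr C \<Longrightarrow> cod1 C f \<in> Obj C"
  by (rule dom1_Obj cod1_Obj, assumption)+

lemma one1_simps [simp]:
  assumes "X \<in> Obj C"
  shows "one1 C X \<in> Arr C" "dom1 C (one1 C X) = X" "cod1 C (one1 C X) = X"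
  using one1_hom[OF assms] by (auto simp: in_hom1_def)

lemma comp1_simps [simp]:
  assumes "f \<in> Arr C" "g \<in> Arr C" "dom1 C g = cod1 C f"
  shows "g \<odot> f \<in> Arr C" "dom1 C (g \<odot> f) = dom1 C f" "cod1 C (g \<odot> f) = cod1 C g"
  using comp1_hom[of f "dom1 C f" "cod1 C f" g "cod1 C g"] assms by (auto simp: in_hom1_def)

lemma comp1_one_simps [simp]:
  "\<lbrakk>f \<in> Arr C; cod1 C f = Y\<rbrakk> \<Longrightarrow> one1 C Y \<odot> f = f"
  "\<lbrakk>f \<in> Arr C; dom1 C f = X\<rbrakk> \<Longrightarrow> f \<odot> one1 C X = f"
  using comp1_one_left[of f "dom1 C f" Y] comp1_one_right[of f X "cod1 C f"]
  by (auto simp: in_hom1_def)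

lemma comp1_assoc' [simp]:
  "\<lbrakk>f \<in> Arr C; g \<in> Arr C; h \<in> Arr C; dom1 C g = cod1 C f; dom1 C h = cod1 C g\<rbrakk>
    \<Longrightarrow> (h \<odot> g) \<odot> f = h \<odot> (g \<odot> f)"
  using comp1_assoc[of f "dom1 C f" "cod1 C f" g "cod1 C g" h "cod1 C h"]
  by (auto simp: in_hom1_def)

text \<open>Composites are kept bracketed to the right, so an equation between composites of two 1-cells
  is applied to the first two factors of a longer composite.\<close>

lemma comp1_tail:
  assumes "p \<odot> q = r" "q \<in> Arr C" "p \<in> Arr C" "k \<in> Arr C" "dom1 C p = cod1 C q" "dom1 C q = cod1 C k"
  shows "p \<odot> (q \<odot> k) = r \<odot> k"
  using assms comp1_assoc'[of k q p] by simp

lemma src2_simps [simp]: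
  assumes "\<alpha> \<in> Cell C"
  shows "src2 C \<alpha> \<in> Arr C" "tgt2 C \<alpha> \<in> Arr C"
    "dom1 C (tgt2 C \<alpha>) = dom1 C (src2 C \<alpha>)" "cod1 C (tgt2 C \<alpha>) = cod1 C (src2 C \<alpha>)"
  using src2_Arr tgt2_Arr parallel_dom parallel_cod assms by auto

lemma one2_simps [simp]:
  assumes "f \<in> Arr C"
  shows "one2 C f \<in> Cell C" "src2 C (one2 C f) = f" "tgt2 C (one2 C f) = f"
  using one2_hom[OF assms] by (auto simp: in_hom2_def)

lemma vcomp_simps [simp]:
  assumes "\<alpha> \<in> Cell C" "\<beta> \<in> Cell C" "src2 C \<beta> = tgt2 C \<alpha>"
  shows "\<beta> \<bullet> \<alpha> \<in> Cell C" "src2 C (\<beta> \<bullet> \<alpha>) = src2 C \<alpha>" "tgt2 C (\<beta> \<bullet> \<alpha>) = tgt2 C \<beta>"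
  using vcomp_hom[of \<alpha> "src2 C \<alpha>" "tgt2 C \<alpha>" \<beta> "tgt2 C \<beta>"] assms by (auto simp: in_hom2_def)

lemma vcomp_one_simps [simp]:
  "\<lbrakk>\<alpha> \<in> Cell C; tgt2 C \<alpha> = g\<rbrakk> \<Longrightarrow> one2 C g \<bullet> \<alpha> = \<alpha>"
  "\<lbrakk>\<alpha> \<in> Cell C; src2 C \<alpha> = f\<rbrakk> \<Longrightarrow> \<alpha> \<bullet> one2 C f = \<alpha>"
  using vcomp_one_left[of \<alpha> "src2 C \<alpha>" g] vcomp_one_right[of \<alpha> f "tgt2 C \<alpha>"]
  by (auto simp: in_hom2_def)

lemma vcomp_assoc' [simp]:
  "\<lbrakk>\<alpha> \<in> Cell C; \<beta> \<in> Cell C; \<gamma> \<in> Cell C; src2 C \<beta> = tgt2 C \<alpha>; src2 C \<gamma> = tgt2 C \<beta>\<rbrakk>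
    \<Longrightarrow> (\<gamma> \<bullet> \<beta>) \<bullet> \<alpha> = \<gamma> \<bullet> (\<beta> \<bullet> \<alpha>)"
  using vcomp_assoc[of \<alpha> "src2 C \<alpha>" "tgt2 C \<alpha>" \<beta> "tgt2 C \<beta>" \<gamma> "tgt2 C \<gamma>"]
  by (auto simp: in_hom2_def)

lemma lwhisker_simps [simp]:
  assumes "\<alpha> \<in> Cell C" "g \<in> Arr C" "dom1 C g = cod1 C (src2 C \<alpha>)"
  shows "g \<rhd> \<alpha> \<in> Cell C" "src2 C (g \<rhd> \<alpha>) = g \<odot> src2 C \<alpha>" "tgt2 C (g \<rhd> \<alpha>) = g \<odot> tgt2 C \<alpha>"
  using hcomp_hom[of \<alpha> "src2 C \<alpha>" "tgt2 C \<alpha>" "dom1 C (src2 C \<alpha>)" "cod1 C (src2 C \<alpha>)"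
      "one2 C g" g g "cod1 C g"] assms
  by (auto simp: in_hom1_def in_hom2_def lwhisker_def)

lemma rwhisker_simps [simp]:
  assumes "\<alpha> \<in> Cell C" "f \<in> Arr C" "dom1 C (src2 C \<alpha>) = cod1 C f"
  shows "\<alpha> \<lhd> f \<in> Cell C" "src2 C (\<alpha> \<lhd> f) = src2 C \<alpha> \<odot> f" "tgt2 C (\<alpha> \<lhd> f) = tgt2 C \<alpha> \<odot> f"
  using hcomp_hom[of "one2 C f" f f "dom1 C f" "cod1 C f" \<alpha> "src2 C \<alpha>" "tgt2 C \<alpha>" "cod1 C (src2 C \<alpha>)"]
    assms
  by (auto simp: in_hom1_def in_hom2_def rwhisker_def)

lemma whisker_one1 [simp]:
  "\<lbrakk>\<alpha> \<in> Cell C; cod1 C (src2 C \<alpha>) = Y\<rbrakk> \<Longrightarrow> one1 C Y \<rhd> \<alpha> = \<alpha>"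
  "\<lbrakk>\<alpha> \<in> Cell C; dom1 C (src2 C \<alpha>) = X\<rbrakk> \<Longrightarrow> \<alpha> \<lhd> one1 C X = \<alpha>"
  using hcomp_one_left[of \<alpha> "src2 C \<alpha>" "tgt2 C \<alpha>" "dom1 C (src2 C \<alpha>)" Y]
    hcomp_one_right[of \<alpha> "src2 C \<alpha>" "tgt2 C \<alpha>" X "cod1 C (src2 C \<alpha>)"]
  by (auto simp: in_hom1_def in_hom2_def lwhisker_def rwhisker_def)

lemma whisker_one2 [simp]:
  "\<lbrakk>f \<in> Arr C; g \<in> Arr C; dom1 C g = cod1 C f\<rbrakk> \<Longrightarrow> g \<rhd> one2 C f = one2 C (g \<odot> f)"
  "\<lbrakk>f \<in> Arr C; g \<in> Arr C; dom1 C g = cod1 C f\<rbrakk> \<Longrightarrow> one2 C g \<lhd> f = one2 C (g \<odot> f)"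
  using hcomp_one2[of f "dom1 C f" "cod1 C f" g "cod1 C g"]
  by (auto simp: in_hom1_def lwhisker_def rwhisker_def)

lemma whisker_comp1 [simp]:
  "\<lbrakk>\<alpha> \<in> Cell C; g \<in> Arr C; h \<in> Arr C; dom1 C g = cod1 C (src2 C \<alpha>); dom1 C h = cod1 C g\<rbrakk>
    \<Longrightarrow> (h \<odot> g) \<rhd> \<alpha> = h \<rhd> (g \<rhd> \<alpha>)"
  "\<lbrakk>\<alpha> \<in> Cell C; f \<in> Arr C; e \<in> Arr C; dom1 C (src2 C \<alpha>) = cod1 C f; dom1 C f = cod1 C e\<rbrakk>
    \<Longrightarrow> \<alpha> \<lhd> (f \<odot> e) = (\<alpha> \<lhd> f) \<lhd> e"
  "\<lbrakk>\<alpha> \<in> Cell C; f \<in> Arr C; g \<in> Arr C; dom1 C (src2 C \<alpha>) = cod1 C f; dom1 C g = cod1 C (src2 C \<alpha>)\<rbrakk>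
    \<Longrightarrow> (g \<rhd> \<alpha>) \<lhd> f = g \<rhd> (\<alpha> \<lhd> f)"
  using
    hcomp_assoc[of \<alpha> "src2 C \<alpha>" "tgt2 C \<alpha>" "dom1 C (src2 C \<alpha>)" "cod1 C (src2 C \<alpha>)"
      "one2 C g" g g "cod1 C g" "one2 C h" h h "cod1 C h"]
    hcomp_assoc[of "one2 C e" e e "dom1 C e" "cod1 C e" "one2 C f" f f "cod1 C f"
      \<alpha> "src2 C \<alpha>" "tgt2 C \<alpha>" "cod1 C (src2 C \<alpha>)"]
    hcomp_assoc[of "one2 C f" f f "dom1 C f" "cod1 C f" \<alpha> "src2 C \<alpha>" "tgt2 C \<alpha>"
      "cod1 C (src2 C \<alpha>)" "one2 C g" g g "cod1 C g"]
    hcomp_one2[of g "dom1 C g" "cod1 C g" h "cod1 C h"]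
    hcomp_one2[of e "dom1 C e" "cod1 C e" f "cod1 C f"]
  by (auto simp: in_hom1_def in_hom2_def lwhisker_def rwhisker_def)

lemma whisker_vcomp [simp]:
  "\<lbrakk>\<alpha> \<in> Cell C; \<beta> \<in> Cell C; src2 C \<beta> = tgt2 C \<alpha>; g \<in> Arr C; dom1 C g = cod1 C (src2 C \<alpha>)\<rbrakk>
    \<Longrightarrow> g \<rhd> (\<beta> \<bullet> \<alpha>) = (g \<rhd> \<beta>) \<bullet> (g \<rhd> \<alpha>)"
  "\<lbrakk>\<alpha> \<in> Cell C; \<beta> \<in> Cell C; src2 C \<beta> = tgt2 C \<alpha>; f \<in> Arr C; dom1 C (src2 C \<alpha>) = cod1 C f\<rbrakk>
    \<Longrightarrow> (\<beta> \<bullet> \<alpha>) \<lhd> f = (\<beta> \<lhd> f) \<bullet> (\<alpha> \<lhd> f)"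
  using
    interchange[of \<alpha> "src2 C \<alpha>" "tgt2 C \<alpha>" \<beta> "tgt2 C \<beta>" "dom1 C (src2 C \<alpha>)" "cod1 C (src2 C \<alpha>)"
      "one2 C g" g g "one2 C g" g "cod1 C g"]
    interchange[of "one2 C f" f f "one2 C f" f "dom1 C f" "cod1 C f"
      \<alpha> "src2 C \<alpha>" "tgt2 C \<alpha>" \<beta> "tgt2 C \<beta>" "cod1 C (src2 C \<alpha>)"]
  by (auto simp: in_hom1_def in_hom2_def lwhisker_def rwhisker_def)

lemma invertible2_lwhisker:
  assumes "invertible2 C \<alpha>" "g \<in> Arr C" "dom1 C g = cod1 C (src2 C \<alpha>)"
  shows "invertible2 C (g \<rhd> \<alpha>)"
proof -
  obtain \<beta> where "\<alpha> \<in> Cell C" "\<beta> \<in> Cell C" "src2 C \<beta> = tgt2 C \<alpha>" "tgt2 C \<beta> = src2 C \<alpha>"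
    "\<beta> \<bullet> \<alpha> = one2 C (src2 C \<alpha>)" "\<alpha> \<bullet> \<beta> = one2 C (tgt2 C \<alpha>)"
    using assms by (auto simp: invertible2_def in_hom2_def)
  then show ?thesis
    unfolding invertible2_def using assms(2,3)
    by (auto intro!: exI[of _ "g \<rhd> \<beta>"] simp: in_hom2_def simp flip: whisker_vcomp)
qed

lemma invertible2_rwhisker:
  assumes "invertible2 C \<alpha>" "f \<in> Arr C" "dom1 C (src2 C \<alpha>) = cod1 C f"
  shows "invertible2 C (\<alpha> \<lhd> f)"
proof -
  obtain \<beta> where "\<alpha> \<in> Cell C" "\<beta> \<in> Cell C" "src2 C \<beta> = tgt2 C \<alpha>" "tgt2 C \<beta> = src2 C \<alpha>"
    "\<beta> \<bullet> \<alpha> = one2 C (src2 C \<alpha>)" "\<alpha> \<bullet> \<beta> = one2 C (tgt2 C \<alpha>)"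
    using assms by (auto simp: invertible2_def in_hom2_def)
  then show ?thesis
    unfolding invertible2_def using assms(2,3)
    by (auto intro!: exI[of _ "\<beta> \<lhd> f"] simp: in_hom2_def simp flip: whisker_vcomp)
qed

lemma invertible2_vcomp:
  assumes "invertible2 C \<alpha>" "invertible2 C \<beta>" "src2 C \<beta> = tgt2 C \<alpha>"
  shows "invertible2 C (\<beta> \<bullet> \<alpha>)"
proof -
  obtain \<alpha>' where \<alpha>: "\<alpha> \<in> Cell C" "\<alpha>' \<in> Cell C" "src2 C \<alpha>' = tgt2 C \<alpha>" "tgt2 C \<alpha>' = src2 C \<alpha>"
    "\<alpha>' \<bullet> \<alpha> = one2 C (src2 C \<alpha>)" "\<alpha> \<bullet> \<alpha>' = one2 C (tgt2 C \<alpha>)"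
    using assms by (auto simp: invertible2_def in_hom2_def)
  obtain \<beta>' where \<beta>: "\<beta> \<in> Cell C" "\<beta>' \<in> Cell C" "src2 C \<beta>' = tgt2 C \<beta>" "tgt2 C \<beta>' = src2 C \<beta>"
    "\<beta>' \<bullet> \<beta> = one2 C (src2 C \<beta>)" "\<beta> \<bullet> \<beta>' = one2 C (tgt2 C \<beta>)"
    using assms by (auto simp: invertible2_def in_hom2_def)
  have "\<beta>' \<bullet> (\<beta> \<bullet> \<alpha>) = \<alpha>" "\<alpha> \<bullet> (\<alpha>' \<bullet> \<beta>') = \<beta>'"
    using vcomp_assoc'[of \<alpha> \<beta> \<beta>'] vcomp_assoc'[of \<beta>' \<alpha>' \<alpha>] \<alpha> \<beta> assms(3) by simp_all
  then show ?thesis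
    unfolding invertible2_def using \<alpha> \<beta> assms(3)
    by (auto intro!: exI[of _ "\<alpha>' \<bullet> \<beta>'"] simp: in_hom2_def)
qed

end

context two_functor
begin

lemma on0_simp [simp]: "X \<in> Obj C \<Longrightarrow> on0 F X \<in> Obj C"
  by (rule on0_Obj)

lemma on1_simps [simp]:
  assumes "f \<in> Arr C"
  shows "on1 F f \<in> Arr C" "dom1 C (on1 F f) = on0 F (dom1 C f)" "cod1 C (on1 F f) = on0 F (cod1 C f)"
  using on1_hom[of f "dom1 C f" "cod1 C f"] assms by (auto simp: in_hom1_def)

lemma on1_one1' [simp]: "X \<in> Obj C \<Longrightarrow> on1 F (one1 C X) = one1 C (on0 F X)"
  by (rule on1_one1)

lemma on1_comp1' [simp]:
  "\<lbrakk>f \<in> Arr C; g \<in> Arr C; dom1 C g = cod1 C f\<rbrakk> \<Longrightarrow> on1 F (g \<odot> f) = on1 F g \<odot> on1 F f"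
  using on1_comp1[of f "dom1 C f" "cod1 C f" g "cod1 C g"] by (auto simp: in_hom1_def)

lemma on2_simps [simp]:
  assumes "\<alpha> \<in> Cell C"
  shows "on2 F \<alpha> \<in> Cell C" "src2 C (on2 F \<alpha>) = on1 F (src2 C \<alpha>)" "tgt2 C (on2 F \<alpha>) = on1 F (tgt2 C \<alpha>)"
  using on2_hom[of \<alpha> "src2 C \<alpha>" "tgt2 C \<alpha>"] assms by (auto simp: in_hom2_def)

lemma on2_one2' [simp]: "f \<in> Arr C \<Longrightarrow> on2 F (one2 C f) = one2 C (on1 F f)"
  by (rule on2_one2)

lemma on2_vcomp' [simp]:
  "\<lbrakk>\<alpha> \<in> Cell C; \<beta> \<in> Cell C; src2 C \<beta> = tgt2 C \<alpha>\<rbrakk> \<Longrightarrow> on2 F (\<beta> \<bullet> \<alpha>) = on2 F \<beta> \<bullet> on2 F \<alpha>"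
  using on2_vcomp[of \<alpha> "src2 C \<alpha>" "tgt2 C \<alpha>" \<beta> "tgt2 C \<beta>"] by (auto simp: in_hom2_def)

lemma on2_whisker [simp]:
  "\<lbrakk>\<alpha> \<in> Cell C; g \<in> Arr C; dom1 C g = cod1 C (src2 C \<alpha>)\<rbrakk> \<Longrightarrow> on2 F (g \<rhd> \<alpha>) = on1 F g \<rhd> on2 F \<alpha>"
  "\<lbrakk>\<alpha> \<in> Cell C; f \<in> Arr C; dom1 C (src2 C \<alpha>) = cod1 C f\<rbrakk> \<Longrightarrow> on2 F (\<alpha> \<lhd> f) = on2 F \<alpha> \<lhd> on1 F f"
  using
    on2_hcomp[of \<alpha> "src2 C \<alpha>" "tgt2 C \<alpha>" "dom1 C (src2 C \<alpha>)" "cod1 C (src2 C \<alpha>)"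
      "one2 C g" g g "cod1 C g"]
    on2_hcomp[of "one2 C f" f f "dom1 C f" "cod1 C f" \<alpha> "src2 C \<alpha>" "tgt2 C \<alpha>" "cod1 C (src2 C \<alpha>)"]
  by (auto simp: in_hom1_def in_hom2_def lwhisker_def rwhisker_def)

lemma on2_invertible2:
  assumes "invertible2 C \<alpha>"
  shows "invertible2 C (on2 F \<alpha>)"
proof -
  obtain \<beta> where "\<alpha> \<in> Cell C" "\<beta> \<in> Cell C" "src2 C \<beta> = tgt2 C \<alpha>" "tgt2 C \<beta> = src2 C \<alpha>"
    "\<beta> \<bullet> \<alpha> = one2 C (src2 C \<alpha>)" "\<alpha> \<bullet> \<beta> = one2 C (tgt2 C \<alpha>)"
    using assms by (auto simp: invertible2_def in_hom2_def)
  then show ?thesis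
    unfolding invertible2_def
    by (auto intro!: exI[of _ "on2 F \<beta>"] simp: in_hom2_def simp flip: on2_vcomp')
qed

end

lemma id_functor_simps [simp]:
  "on0 id_functor = (\<lambda>X. X)" "on1 id_functor = (\<lambda>f. f)" "on2 id_functor = (\<lambda>\<alpha>. \<alpha>)"
  by (simp_all add: id_functor_def)

lemma comp_functor_simps [simp]:
  "on0 (G \<circ>\<^sub>F F) X = on0 G (on0 F X)"
  "on1 (G \<circ>\<^sub>F F) f = on1 G (on1 F f)"
  "on2 (G \<circ>\<^sub>F F) \<alpha> = on2 G (on2 F \<alpha>)"
  by (simp_all add: comp_functor_def)

context two_natural
begin

lemma component_simps [simp]:
  assumes "X \<in> Obj C"
  shows "\<theta> X \<in> Arr C" "dom1 C (\<theta> X) = on0 F X" "cod1 C (\<theta> X) = on0 G X"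
  using component[OF assms] by (auto simp: in_hom1_def)

lemma naturality:
  "\<lbrakk>f \<in> Arr C; dom1 C f = X; cod1 C f = Y\<rbrakk> \<Longrightarrow> \<theta> Y \<odot> on1 F f = on1 G f \<odot> \<theta> X"
  using natural1[of f X Y] by (simp add: in_hom1_def)

lemma naturality2:
  "\<lbrakk>\<alpha> \<in> Cell C; dom1 C (src2 C \<alpha>) = X; cod1 C (src2 C \<alpha>) = Y\<rbrakk> \<Longrightarrow> \<theta> Y \<rhd> on2 F \<alpha> = on2 G \<alpha> \<lhd> \<theta> X"
  using natural2[of \<alpha> "src2 C \<alpha>" "tgt2 C \<alpha>" X Y] by (simp add: in_hom1_def in_hom2_def)

end

text \<open>A record for a monad carries more than a functor; being a 2-functor or 2-natural depends on
  the functor fields alone.\<close>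

lemma two_functor_cong:
  assumes "on0 F = on0 F'" "on1 F = on1 F'" "on2 F = on2 F'"
  shows "two_functor C F \<longleftrightarrow> two_functor C F'"
  by (simp add: two_functor_def two_functor_axioms_def assms)

lemma two_natural_cong:
  assumes "on0 F = on0 F'" "on1 F = on1 F'" "on2 F = on2 F'"
    and "on0 G = on0 G'" "on1 G = on1 G'" "on2 G = on2 G'"
  shows "two_natural C F G \<theta> \<longleftrightarrow> two_natural C F' G' \<theta>"
  by (simp add: two_natural_def two_natural_axioms_def assms
      two_functor_cong[OF assms(1-3)] two_functor_cong[OF assms(4-6)])

lemma two_functor_comp:
  assumes "two_functor C F" "two_functor C G"
  shows "two_functor C (G \<circ>\<^sub>F F)"
proof -
  interpret F: two_functor C F by fact
  interpret G: two_functor C G by fact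
  show ?thesis
    by unfold_locales
      (auto simp: in_hom1_def in_hom2_def F.on2_hcomp G.on2_hcomp)
qed


section \<open>Composing 2-natural transformations\<close>

lemma two_natural_vcomp:
  assumes "two_natural C F G \<theta>" "two_natural C G H \<phi>"
  shows "two_natural C F H (\<lambda>X. \<phi> X \<odot>\<^bsub>C\<^esub> \<theta> X)"
proof -
  interpret \<theta>: two_natural C F G \<theta> by fact
  interpret \<phi>: two_natural C G H \<phi> by fact
  show ?thesis
  proof unfold_locales
    fix f X Y assume "in_hom1 C f X Y"
    then have f: "f \<in> Arr C" "dom1 C f = X" "cod1 C f = Y" and X: "X \<in> Obj C" "Y \<in> Obj C"
      by (auto simp: in_hom1_def)
    show "(\<phi> Y \<odot>\<^bsub>C\<^esub> \<theta> Y) \<odot>\<^bsub>C\<^esub> on1 F f = on1 H f \<odot>\<^bsub>C\<^esub> \<phi> X \<odot>\<^bsub>C\<^esub> \<theta> X"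
      using \<theta>.naturality[OF f] \<theta>.dom.comp1_tail[OF \<phi>.naturality[OF f], of "\<theta> X"] f X by simp
  next
    fix \<alpha> f g X Y assume "in_hom2 C \<alpha> f g" "in_hom1 C f X Y"
    then have \<alpha>: "\<alpha> \<in> Cell C" "dom1 C (src2 C \<alpha>) = X" "cod1 C (src2 C \<alpha>) = Y"
      and X: "X \<in> Obj C" "Y \<in> Obj C"
      by (auto simp: in_hom1_def in_hom2_def)
    have "\<phi> Y \<rhd>\<^bsub>C\<^esub> (on2 G \<alpha> \<lhd>\<^bsub>C\<^esub> \<theta> X) = (\<phi> Y \<rhd>\<^bsub>C\<^esub> on2 G \<alpha>) \<lhd>\<^bsub>C\<^esub> \<theta> X"
      using \<alpha> X by simp
    then show "(\<phi> Y \<odot>\<^bsub>C\<^esub> \<theta> Y) \<rhd>\<^bsub>C\<^esub> on2 F \<alpha> = on2 H \<alpha> \<lhd>\<^bsub>C\<^esub> (\<phi> X \<odot>\<^bsub>C\<^esub> \<theta> X)"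
      using \<theta>.naturality2[OF \<alpha>] \<phi>.naturality2[OF \<alpha>] \<alpha> X by simp
  qed (auto simp: in_hom1_def)
qed

lemma two_natural_lwhisker:
  assumes "two_natural C F F' \<theta>" "two_functor C G"
  shows "two_natural C (G \<circ>\<^sub>F F) (G \<circ>\<^sub>F F') (\<lambda>X. on1 G (\<theta> X))"
proof -
  interpret \<theta>: two_natural C F F' \<theta> by fact
  interpret G: two_functor C G by fact
  interpret GF: two_functor C "G \<circ>\<^sub>F F" by (rule two_functor_comp) unfold_locales
  interpret GF': two_functor C "G \<circ>\<^sub>F F'" by (rule two_functor_comp) unfold_locales
  show ?thesis
  proof unfold_locales
    fix f X Y assume "in_hom1 C f X Y"
    then have f: "f \<in> Arr C" "dom1 C f = X" "cod1 C f = Y" and X: "X \<in> Obj C" "Y \<in> Obj C"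
      by (auto simp: in_hom1_def)
    show "on1 G (\<theta> Y) \<odot>\<^bsub>C\<^esub> on1 (G \<circ>\<^sub>F F) f = on1 (G \<circ>\<^sub>F F') f \<odot>\<^bsub>C\<^esub> on1 G (\<theta> X)"
      using arg_cong[where f = "on1 G", OF \<theta>.naturality[OF f]] f X by simp
  next
    fix \<alpha> f g X Y assume "in_hom2 C \<alpha> f g" "in_hom1 C f X Y"
    then have \<alpha>: "\<alpha> \<in> Cell C" "dom1 C (src2 C \<alpha>) = X" "cod1 C (src2 C \<alpha>) = Y"
      and X: "X \<in> Obj C" "Y \<in> Obj C"
      by (auto simp: in_hom1_def in_hom2_def)
    show "on1 G (\<theta> Y) \<rhd>\<^bsub>C\<^esub> on2 (G \<circ>\<^sub>F F) \<alpha> = on2 (G \<circ>\<^sub>F F') \<alpha> \<lhd>\<^bsub>C\<^esub> on1 G (\<theta> X)"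
      using arg_cong[where f = "on2 G", OF \<theta>.naturality2[OF \<alpha>]] \<alpha> X by simp
  qed (auto simp: in_hom1_def)
qed

lemma two_natural_rwhisker:
  assumes "two_natural C F F' \<theta>" "two_functor C H"
  shows "two_natural C (F \<circ>\<^sub>F H) (F' \<circ>\<^sub>F H) (\<lambda>X. \<theta> (on0 H X))"
proof -
  interpret \<theta>: two_natural C F F' \<theta> by fact
  interpret H: two_functor C H by fact
  interpret FH: two_functor C "F \<circ>\<^sub>F H" by (rule two_functor_comp) unfold_locales
  interpret FH': two_functor C "F' \<circ>\<^sub>F H" by (rule two_functor_comp) unfold_locales
  show ?thesis
    by unfold_locales (auto simp: in_hom1_def in_hom2_def \<theta>.naturality \<theta>.naturality2)
qed


section \<open>The composite 2-monad\<close>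

lemma composite_monad_simps [simp]:
  "on0 (composite_monad C S T \<Lambda>) X = on0 T (on0 S X)"
  "on1 (composite_monad C S T \<Lambda>) f = on1 T (on1 S f)"
  "on2 (composite_monad C S T \<Lambda>) \<alpha> = on2 T (on2 S \<alpha>)"
  "unit (composite_monad C S T \<Lambda>) X = unit T (on0 S X) \<odot>\<^bsub>C\<^esub> unit S X"
  "mult (composite_monad C S T \<Lambda>) X =
    (mult T (on0 S X) \<odot>\<^bsub>C\<^esub> on1 T (on1 T (mult S X))) \<odot>\<^bsub>C\<^esub> on1 T (\<Lambda> (on0 S X))"
  by (simp_all add: composite_monad_def)

context distributive_law
begin

lemma composite_two_functor: "two_functor C (composite_monad C S T \<Lambda>)"
  using two_functor_comp[of C S T] S.two_functor_axioms T.two_functor_axioms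
  by (subst two_functor_cong[of _ "T \<circ>\<^sub>F S"]) (auto simp: comp_functor_def composite_monad_def)

lemma composite_unit_two_natural:
  "two_natural C id_functor (composite_monad C S T \<Lambda>) (unit (composite_monad C S T \<Lambda>))"
proof -
  have "two_natural C id_functor (T \<circ>\<^sub>F S) (\<lambda>X. unit T (on0 S X) \<odot> unit S X)"
  proof (rule two_natural_vcomp)
    show "two_natural C id_functor S (unit S)" by (rule S.unit.two_natural_axioms)
    show "two_natural C S (T \<circ>\<^sub>F S) (\<lambda>X. unit T (on0 S X))"
      using two_natural_rwhisker[OF T.unit.two_natural_axioms S.two_functor_axioms]
      by (subst two_natural_cong[of _ "id_functor \<circ>\<^sub>F S" _ "T \<circ>\<^sub>F S"])
        (auto simp: comp_functor_def)
  qed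
  then show ?thesis
    by (subst two_natural_cong[of _ id_functor _ "T \<circ>\<^sub>F S"])
      (auto simp: comp_functor_def composite_monad_def)
qed

text \<open>
  The multiplication is a vertical composite of whiskerings of the 2-natural transformations \<open>\<Lambda>\<close>,
  \<open>mult S\<close> and \<open>mult T\<close>, and so inherits 2-naturality from them.
\<close>

lemma composite_mult_two_natural:
  "two_natural C (composite_monad C S T \<Lambda> \<circ>\<^sub>F composite_monad C S T \<Lambda>)
    (composite_monad C S T \<Lambda>) (mult (composite_monad C S T \<Lambda>))"
proof -
  have "two_natural C (T \<circ>\<^sub>F ((S \<circ>\<^sub>F T) \<circ>\<^sub>F S)) (T \<circ>\<^sub>F S)
    (\<lambda>X. (mult T (on0 S X) \<odot> on1 T (on1 T (mult S X))) \<odot> on1 T (\<Lambda> (on0 S X)))"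
  proof (rule two_natural_vcomp[OF _ two_natural_vcomp])
    show "two_natural C (T \<circ>\<^sub>F ((S \<circ>\<^sub>F T) \<circ>\<^sub>F S)) (T \<circ>\<^sub>F ((T \<circ>\<^sub>F S) \<circ>\<^sub>F S)) (\<lambda>X. on1 T (\<Lambda> (on0 S X)))"
      by (rule two_natural_lwhisker[OF two_natural_rwhisker]) unfold_locales
    show "two_natural C (T \<circ>\<^sub>F ((T \<circ>\<^sub>F S) \<circ>\<^sub>F S)) (T \<circ>\<^sub>F T \<circ>\<^sub>F S) (\<lambda>X. on1 T (on1 T (mult S X)))"
      using two_natural_lwhisker[OF two_natural_lwhisker[OF S.mult.two_natural_axioms
            T.two_functor_axioms] T.two_functor_axioms]
      by (subst two_natural_cong[of _ "T \<circ>\<^sub>F T \<circ>\<^sub>F S \<circ>\<^sub>F S" _ "T \<circ>\<^sub>F T \<circ>\<^sub>F S"])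
        (auto simp: comp_functor_def o_def)
    show "two_natural C (T \<circ>\<^sub>F T \<circ>\<^sub>F S) (T \<circ>\<^sub>F S) (\<lambda>X. mult T (on0 S X))"
      using two_natural_rwhisker[OF T.mult.two_natural_axioms S.two_functor_axioms]
      by (subst two_natural_cong[of _ "(T \<circ>\<^sub>F T) \<circ>\<^sub>F S" _ "T \<circ>\<^sub>F S"])
        (auto simp: comp_functor_def o_def)
  qed
  then show ?thesis
    by (subst two_natural_cong[of _ "T \<circ>\<^sub>F ((S \<circ>\<^sub>F T) \<circ>\<^sub>F S)" _ "T \<circ>\<^sub>F S"])
      (auto simp: comp_functor_def composite_monad_def o_def)
qed

lemma composite_mult_assoc:
  assumes X [simp]: "X \<in> Obj C"
  shows "mult (composite_monad C S T \<Lambda>) X \<odot>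
      on1 (composite_monad C S T \<Lambda>) (mult (composite_monad C S T \<Lambda>) X) =
    mult (composite_monad C S T \<Lambda>) X \<odot>
      mult (composite_monad C S T \<Lambda>) (on0 (composite_monad C S T \<Lambda>) X)"
proof -
  let ?S = "on1 S" and ?T = "on1 T" and ?SX = "on0 S X"
  let ?SSX = "on0 S ?SX" and ?TSX = "on0 T ?SX"
  let ?STSX = "on0 S ?TSX" and ?TSSX = "on0 T (on0 S ?SX)"
  let ?n = "mult S X"
  have a: "?T (\<Lambda> ?SX) \<odot> ?T (?S (mult T ?SX)) =
      ?T (mult T ?SSX) \<odot> ?T (?T (\<Lambda> ?SX)) \<odot> ?T (\<Lambda> ?TSX)"
    using arg_cong[where f = ?T, OF law_mult_T[of ?SX]] by simp
  have b: "?T (?T ?n) \<odot> ?T (mult T ?SSX) = ?T (mult T ?SX) \<odot> ?T (?T (?T ?n))"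
    using arg_cong[where f = ?T, OF T.mult.naturality[of ?n, OF _ refl refl]] by simp
  have c: "mult T ?SX \<odot> ?T (mult T ?SX) = mult T ?SX \<odot> mult T ?TSX"
    by (simp add: T.mult_assoc)
  have d: "?T (\<Lambda> ?TSX) \<odot> ?T (?S (?T (?T ?n))) = ?T (?T (?S (?T ?n))) \<odot> ?T (\<Lambda> ?TSSX)"
    using arg_cong[where f = ?T, OF law.naturality[of "?T ?n", OF _ refl refl]] by simp
  have e: "?T (?T (\<Lambda> ?SX)) \<odot> ?T (?T (?S (?T ?n))) = ?T (?T (?T (?S ?n))) \<odot> ?T (?T (\<Lambda> ?SSX))"
    using arg_cong[where f = "\<lambda>f. ?T (?T f)", OF law.naturality[of ?n, OF _ refl refl]] by simp
  have f: "?T (?T (?T ?n)) \<odot> ?T (?T (?T (?S ?n))) = ?T (?T (?T ?n)) \<odot> ?T (?T (?T (mult S ?SX)))"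
    using arg_cong[where f = "\<lambda>f. ?T (?T (?T f))", OF S.mult_assoc[OF X]] by simp
  have g: "?T (\<Lambda> ?TSSX) \<odot> ?T (?S (?T (\<Lambda> ?SX))) = ?T (?T (?S (\<Lambda> ?SX))) \<odot> ?T (\<Lambda> ?STSX)"
    using arg_cong[where f = ?T, OF law.naturality[of "\<Lambda> ?SX", OF _ refl refl]] by simp
  have h: "?T (\<Lambda> ?SX) \<odot> mult T ?STSX = mult T ?TSSX \<odot> ?T (?T (\<Lambda> ?SX))"
    using T.mult.naturality[of "\<Lambda> ?SX"] by simp
  have i: "?T (?T ?n) \<odot> mult T ?TSSX = mult T ?TSX \<odot> ?T (?T (?T ?n))"
    using T.mult.naturality[of "?T ?n"] by simp
  have j: "?T (?T (\<Lambda> ?SX)) \<odot> ?T (?T (mult S ?TSX)) =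
      ?T (?T (?T (mult S ?SX))) \<odot> ?T (?T (\<Lambda> ?SSX)) \<odot> ?T (?T (?S (\<Lambda> ?SX)))"
    using arg_cong[where f = "\<lambda>f. ?T (?T f)", OF law_mult_S[of ?SX]] by simp
  \<comment> \<open>Used from left to right, these equations collect the multiplications of \<open>T\<close> first, then those
    of \<open>S\<close>, then the components of \<open>\<Lambda>\<close>. With \<open>m\<close> for \<open>mult T\<close>, \<open>n\<close> for \<open>mult S\<close> and, say,
    \<open>m\<^sub>T\<^sub>S\<close> for the component of \<open>m\<close> at \<open>TSX\<close>, both sides become
    \<open>m\<^sub>S m\<^sub>T\<^sub>S TTTn TTTn\<^sub>S TT\<Lambda>\<^sub>S\<^sub>S TTS\<Lambda>\<^sub>S T\<Lambda>\<^sub>S\<^sub>T\<^sub>S\<close>.\<close>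
  show ?thesis
    by (simp add: a b c d e f g h i j a[THEN S.comp1_tail] b[THEN S.comp1_tail]
      c[THEN S.comp1_tail] d[THEN S.comp1_tail] e[THEN S.comp1_tail] f[THEN S.comp1_tail]
      g[THEN S.comp1_tail] h[THEN S.comp1_tail] i[THEN S.comp1_tail] j[THEN S.comp1_tail])
qed

lemma composite_mult_unit_inner:
  assumes X [simp]: "X \<in> Obj C"
  shows "mult (composite_monad C S T \<Lambda>) X \<odot>
      on1 (composite_monad C S T \<Lambda>) (unit (composite_monad C S T \<Lambda>) X) =
    one1 C (on0 (composite_monad C S T \<Lambda>) X)"
proof -
  let ?S = "on1 S" and ?T = "on1 T" and ?SX = "on0 S X"
  have a: "?T (\<Lambda> ?SX) \<odot> ?T (?S (unit T ?SX)) = ?T (unit T (on0 S ?SX))"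
    using arg_cong[where f = ?T, OF law_unit_T[of ?SX]] by simp
  have b: "?T (?T (mult S X)) \<odot> ?T (unit T (on0 S ?SX)) = ?T (unit T ?SX) \<odot> ?T (mult S X)"
    using arg_cong[where f = ?T, OF T.unit.naturality[of "mult S X", OF _ refl refl]] by simp
  have c: "mult T ?SX \<odot> ?T (unit T ?SX) = one1 C (on0 T ?SX)"
    by (simp add: T.mult_unit_inner)
  have d: "?T (mult S X) \<odot> ?T (?S (unit S X)) = one1 C (on0 T ?SX)"
    using arg_cong[where f = ?T, OF S.mult_unit_inner[OF X]] by simp
  show ?thesis
    by (simp add: a b c d a[THEN S.comp1_tail] b[THEN S.comp1_tail] c[THEN S.comp1_tail])
qed

lemma composite_mult_unit_outer:
  assumes X [simp]: "X \<in> Obj C"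
  shows "mult (composite_monad C S T \<Lambda>) X \<odot>
      unit (composite_monad C S T \<Lambda>) (on0 (composite_monad C S T \<Lambda>) X) =
    one1 C (on0 (composite_monad C S T \<Lambda>) X)"
proof -
  let ?S = "on1 S" and ?T = "on1 T" and ?SX = "on0 S X"
  let ?TSX = "on0 T ?SX"
  have a: "?T (\<Lambda> ?SX) \<odot> unit T (on0 S ?TSX) = unit T (on0 T (on0 S ?SX)) \<odot> \<Lambda> ?SX"
    using T.unit.naturality[of "\<Lambda> ?SX"] by simp
  have b: "\<Lambda> ?SX \<odot> unit S ?TSX = ?T (unit S ?SX)"
    by (simp add: law_unit_S)
  have c: "?T (?T (mult S X)) \<odot> unit T (on0 T (on0 S ?SX)) = unit T ?TSX \<odot> ?T (mult S X)"
    using T.unit.naturality[of "?T (mult S X)"] by simp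
  have d: "mult T ?SX \<odot> unit T ?TSX = one1 C ?TSX"
    by (simp add: T.mult_unit_outer)
  have e: "?T (mult S X) \<odot> ?T (unit S ?SX) = one1 C ?TSX"
    using arg_cong[where f = ?T, OF S.mult_unit_outer[OF X]] by simp
  show ?thesis
    by (simp add: a b c d e a[THEN S.comp1_tail] c[THEN S.comp1_tail] d[THEN S.comp1_tail])
qed

theorem composite_two_monad: "two_monad C (composite_monad C S T \<Lambda>)"
  using composite_two_functor composite_unit_two_natural composite_mult_two_natural
    composite_mult_assoc composite_mult_unit_inner composite_mult_unit_outer
  by (intro two_monad.intro two_monad_axioms.intro)

end


section \<open>Beck's theorem on algebras of the composite\<close>

context strict_algebra
begin

lemma action_simps [simp]:
  "A \<in> Obj C" "a \<in> Arr C" "dom1 C a = on0 R A" "cod1 C a = A"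
  using carrier action by (auto simp: in_hom1_def)

end

context distributive_pair
begin

text \<open>
  Acting twice alternates \<open>a\<^sub>t\<close> and \<open>a\<^sub>s\<close>. Compatibility exchanges the two actions in the middle, at
  the price of \<open>\<Lambda>\<close>, which brings equal actions together; their associativity then produces
  the two multiplications.
\<close>

theorem composite_strict_algebra:
  "strict_algebra C (composite_monad C S T \<Lambda>) A (a\<^sub>t \<odot> on1 T a\<^sub>s)"
proof -
  interpret TS: two_monad C "composite_monad C S T \<Lambda>" by (rule composite_two_monad)
  let ?S = "on1 S" and ?T = "on1 T"
  have a: "?T a\<^sub>s \<odot> ?T (?S a\<^sub>t) = ?T a\<^sub>t \<odot> ?T (?T a\<^sub>s) \<odot> ?T (\<Lambda> A)"
    using arg_cong[where f = ?T, OF pair_compatible] by simp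
  have b: "a\<^sub>t \<odot> ?T a\<^sub>t = a\<^sub>t \<odot> mult T A"
    by (rule T_alg.action_mult)
  have c: "?T (\<Lambda> A) \<odot> ?T (?S (?T a\<^sub>s)) = ?T (?T (?S a\<^sub>s)) \<odot> ?T (\<Lambda> (on0 S A))"
    using arg_cong[where f = ?T, OF law.naturality[of "a\<^sub>s", OF _ refl refl]] by simp
  have d: "?T (?T a\<^sub>s) \<odot> ?T (?T (?S a\<^sub>s)) = ?T (?T a\<^sub>s) \<odot> ?T (?T (mult S A))"
    using arg_cong[where f = "\<lambda>f. ?T (?T f)", OF S_alg.action_mult] by simp
  have e: "?T a\<^sub>s \<odot> mult T (on0 S A) = mult T A \<odot> ?T (?T a\<^sub>s)"
    using T.mult.naturality[of "a\<^sub>s"] by simp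
  have f: "?T a\<^sub>s \<odot> unit T (on0 S A) = unit T A \<odot> a\<^sub>s"
    using T.unit.naturality[of "a\<^sub>s"] by simp
  have g: "a\<^sub>t \<odot> unit T A = one1 C A" "a\<^sub>s \<odot> unit S A = one1 C A"
    by (rule T_alg.action_unit S_alg.action_unit)+
  show ?thesis
  proof unfold_locales
    show "(a\<^sub>t \<odot> ?T a\<^sub>s) \<odot> on1 (composite_monad C S T \<Lambda>) (a\<^sub>t \<odot> ?T a\<^sub>s) =
        (a\<^sub>t \<odot> ?T a\<^sub>s) \<odot> mult (composite_monad C S T \<Lambda>) A"
      by (simp add: a b c d e a[THEN S.comp1_tail] b[THEN S.comp1_tail] c[THEN S.comp1_tail]
        d[THEN S.comp1_tail] e[THEN S.comp1_tail])
    show "(a\<^sub>t \<odot> ?T a\<^sub>s) \<odot> unit (composite_monad C S T \<Lambda>) A = one1 C A"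
      by (simp add: f g f[THEN S.comp1_tail] g[THEN S.comp1_tail])
  qed (auto simp: in_hom1_def)
qed

lemma composite_action_components:
  "(a\<^sub>t \<odot> on1 T a\<^sub>s) \<odot> on1 T (unit S A) = a\<^sub>t"
  "(a\<^sub>t \<odot> on1 T a\<^sub>s) \<odot> unit T (on0 S A) = a\<^sub>s"
proof -
  have "on1 T a\<^sub>s \<odot> on1 T (unit S A) = one1 C (on0 T A)"
    using arg_cong[where f = "on1 T", OF S_alg.action_unit] by simp
  then show "(a\<^sub>t \<odot> on1 T a\<^sub>s) \<odot> on1 T (unit S A) = a\<^sub>t"
    by simp
  have "on1 T a\<^sub>s \<odot> unit T (on0 S A) = unit T A \<odot> a\<^sub>s"
    using T.unit.naturality[of "a\<^sub>s"] by simp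
  then show "(a\<^sub>t \<odot> on1 T a\<^sub>s) \<odot> unit T (on0 S A) = a\<^sub>s"
    using S.comp1_tail[OF T_alg.action_unit, of "a\<^sub>s"] by simp
qed

end

context distributive_law
begin

text \<open>
  Where two of the actions are composed, \<open>h\<close> occurs twice, and naturality of a unit brings the
  second \<open>h\<close> next to the first as \<open>on1 T (on1 S h)\<close>. Associativity of the composite action then replaces both by one \<open>h\<close>
  after \<open>mult T\<close>, \<open>mult S\<close> and \<open>\<Lambda>\<close>, and the laws of the monads and of \<open>\<Lambda>\<close> at units cancel
  what remains. Both sides of the compatibility condition become \<open>h \<odot> \<Lambda> A\<close> in this way.
\<close>

theorem composite_algebra_components:
  assumes "strict_algebra C (composite_monad C S T \<Lambda>) A h"
  shows "distributive_pair C S T \<Lambda> A (h \<odot> on1 T (unit S A)) (h \<odot> unit T (on0 S A))" (is ?pair)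
    and "h = (h \<odot> on1 T (unit S A)) \<odot> on1 T (h \<odot> unit T (on0 S A))" (is ?split)
proof -
  interpret h: strict_algebra C "composite_monad C S T \<Lambda>" A h by fact
  let ?S = "on1 S" and ?T = "on1 T" and ?SA = "on0 S A"
  let ?SSA = "on0 S ?SA" and ?TSA = "on0 T ?SA" let ?STSA = "on0 S ?TSA"
  let ?t = "h \<odot> ?T (unit S A)" and ?s = "h \<odot> unit T ?SA"
  have h_mult: "h \<odot> ?T (?S h) = h \<odot> mult T ?SA \<odot> ?T (?T (mult S A)) \<odot> ?T (\<Lambda> ?SA)"
    using h.action_mult by simp
  have h_unit: "h \<odot> unit T ?SA \<odot> unit S A = one1 C A"
    using h.action_unit by simp
  have unit_S: "unit S A \<odot> h = ?S h \<odot> unit S ?TSA"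
    using S.unit.naturality[of h] by simp
  have T_unit_S: "?T (unit S A) \<odot> ?T h = ?T (?S h) \<odot> ?T (unit S ?TSA)"
    using arg_cong[where f = ?T, OF unit_S] by simp
  have law_unit_S': "?T (\<Lambda> ?SA) \<odot> ?T (unit S ?TSA) = ?T (?T (unit S ?SA))"
    using arg_cong[where f = ?T, OF law_unit_S[of ?SA]] by simp
  have mult_unit_S: "?T (?T (mult S A)) \<odot> ?T (?T (unit S ?SA)) = one1 C (on0 T ?TSA)"
    using arg_cong[where f = "\<lambda>f. ?T (?T f)", OF S.mult_unit_outer[of A]] by simp
  have unit_T_h: "unit T ?SA \<odot> ?S h = ?T (?S h) \<odot> unit T ?STSA"
    using T.unit.naturality[of "?S h"] by simp
  have unit_T_law: "?T (\<Lambda> ?SA) \<odot> unit T ?STSA = unit T (on0 T ?SSA) \<odot> \<Lambda> ?SA"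
    using T.unit.naturality[of "\<Lambda> ?SA"] by simp
  have unit_T_mult: "?T (?T (mult S A)) \<odot> unit T (on0 T ?SSA) = unit T ?TSA \<odot> ?T (mult S A)"
    using T.unit.naturality[of "?T (mult S A)"] by simp
  have unit_T_mult': "?T (mult S A) \<odot> unit T ?SSA = unit T ?SA \<odot> mult S A"
    using T.unit.naturality[of "mult S A"] by simp
  have mult_unit_T: "mult T ?SA \<odot> ?T (unit T ?SA) = one1 C ?TSA"
    "mult T ?SA \<odot> unit T ?TSA = one1 C ?TSA"
    by (simp_all add: T.mult_unit_inner T.mult_unit_outer)
  have law_unit_T': "\<Lambda> ?SA \<odot> ?S (unit T ?SA) = unit T ?SSA"
    by (simp add: law_unit_T)
  have T_unit_mult: "?T (unit S A) \<odot> mult T A = mult T ?SA \<odot> ?T (?T (unit S A))"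
    using T.mult.naturality[of "unit S A"] by simp
  have T_unit_unit: "?T (unit S A) \<odot> unit T A = unit T ?SA \<odot> unit S A"
    using T.unit.naturality[of "unit S A"] by simp
  have law_S_unit: "\<Lambda> ?SA \<odot> ?S (?T (unit S A)) = ?T (?S (unit S A)) \<odot> \<Lambda> A"
    using law.naturality[of "unit S A"] by simp
  have mult_S_unit: "?T (mult S A) \<odot> ?T (?S (unit S A)) = one1 C ?TSA"
    using arg_cong[where f = ?T, OF S.mult_unit_inner[of A]] by simp
  note eqs = h_mult T_unit_S law_unit_S' mult_unit_S unit_T_h unit_T_law unit_T_mult
    unit_T_mult' mult_unit_T law_unit_T' T_unit_mult T_unit_unit law_S_unit mult_S_unit
  note eqs = eqs eqs[THEN S.comp1_tail]
  have split: "h = ?t \<odot> ?T ?s"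
    by (simp add: eqs)
  then show ?split .
  have "strict_algebra C T A ?t"
    by unfold_locales (simp_all add: in_hom1_def eqs h_unit)
  moreover have "strict_algebra C S A ?s"
    by unfold_locales (simp_all add: in_hom1_def eqs h_unit)
  moreover have "?s \<odot> ?S ?t = ?t \<odot> ?T ?s \<odot> \<Lambda> A"
    by (simp add: eqs)
  ultimately show ?pair
    by (intro distributive_pair.intro distributive_pair_axioms.intro distributive_law_axioms)
qed

end


section \<open>Squares\<close>

datatype ('m, 'c) square = Square (sq_top: 'm) (sq_bot: 'm) (sq_left: 'm) (sq_right: 'm) (sq_cell: 'c)

text \<open>
  For a square with 1-cell \<open>f\<close> on top and \<open>g\<close> at the bottom, pasting another one with top \<open>g\<close>
  below it gives the vertical composite of the two whiskered 2-cells. The boundary 1-cells belong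
  to the data because the 2-cell, which only knows the composites \<open>v \<odot> f\<close> and \<open>g \<odot> u\<close>, does not
  determine them.
\<close>

definition sq_comp ::
    "('o, 'm, 'c, 'z) two_cat_data_scheme \<Rightarrow> ('m, 'c) square \<Rightarrow> ('m, 'c) square \<Rightarrow> ('m, 'c) square"
  where "sq_comp C q p = Square (sq_top p) (sq_bot q)
    (sq_left q \<odot>\<^bsub>C\<^esub> sq_left p) (sq_right q \<odot>\<^bsub>C\<^esub> sq_right p)
    ((sq_cell q \<lhd>\<^bsub>C\<^esub> sq_left p) \<bullet>\<^bsub>C\<^esub> (sq_right q \<rhd>\<^bsub>C\<^esub> sq_cell p))"

text \<open>
  The squares form a category whose objects are the 1-cells of \<open>C\<close>. It is treated as a locally
  discrete 2-category, in which every 2-cell is an identity and is represented by its 1-cell, so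
  that the notions of 2-monad, distributive law and strict algebra, and Beck's theorem about them,
  apply to it as they stand.
\<close>

definition squares ::
    "('o, 'm, 'c, 'z) two_cat_data_scheme \<Rightarrow> ('m, ('m, 'c) square, ('m, 'c) square) two_cat_data"
  where "squares C =
    (let Q = {Square f g u v \<phi> | f g u v \<phi>. f \<in> Arr C \<and> g \<in> Arr C \<and>
        u :\<^bsub>C\<^esub> dom1 C f \<rightarrow> dom1 C g \<and> v :\<^bsub>C\<^esub> cod1 C f \<rightarrow> cod1 C g \<and>
        \<phi> :\<^bsub>C\<^esub> v \<odot>\<^bsub>C\<^esub> f \<rightharpoonup> g \<odot>\<^bsub>C\<^esub> u}
     in \<lparr>Obj = Arr C, Arr = Q, Cell = Q, dom1 = sq_top, cod1 = sq_bot, src2 = (\<lambda>p. p), tgt2 = (\<lambda>p. p),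
       one1 = (\<lambda>f. Square f f (one1 C (dom1 C f)) (one1 C (cod1 C f)) (one2 C f)),
       comp1 = sq_comp C, one2 = (\<lambda>p. p), vcomp = (\<lambda>q p. q), hcomp = sq_comp C\<rparr>)"

lemma Square_in_Arr_squares [simp]:
  "Square f g u v \<phi> \<in> Arr (squares C) \<longleftrightarrow> f \<in> Arr C \<and> g \<in> Arr C \<and>
    u :\<^bsub>C\<^esub> dom1 C f \<rightarrow> dom1 C g \<and> v :\<^bsub>C\<^esub> cod1 C f \<rightarrow> cod1 C g \<and>
    \<phi> :\<^bsub>C\<^esub> v \<odot>\<^bsub>C\<^esub> f \<rightharpoonup> g \<odot>\<^bsub>C\<^esub> u"
  by (simp add: squares_def Let_def)

lemma squares_simps [simp]:
  "Obj (squares C) = Arr C"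
  "Cell (squares C) = Arr (squares C)"
  "dom1 (squares C) = sq_top"
  "cod1 (squares C) = sq_bot"
  "src2 (squares C) = (\<lambda>p. p)"
  "tgt2 (squares C) = (\<lambda>p. p)"
  "one1 (squares C) f = Square f f (one1 C (dom1 C f)) (one1 C (cod1 C f)) (one2 C f)"
  "one2 (squares C) = (\<lambda>p. p)"
  "vcomp (squares C) = (\<lambda>q p. q)"
  "hcomp (squares C) = sq_comp C"
  "comp1 (squares C) (Square f' g' u' v' \<phi>') (Square f g u v \<phi>) =
    Square f g' (u' \<odot>\<^bsub>C\<^esub> u) (v' \<odot>\<^bsub>C\<^esub> v) ((\<phi>' \<lhd>\<^bsub>C\<^esub> u) \<bullet>\<^bsub>C\<^esub> (v' \<rhd>\<^bsub>C\<^esub> \<phi>))"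
  by (simp_all add: squares_def Let_def sq_comp_def)

lemma sq_comp_eq: "sq_comp C = comp1 (squares C)"
  by (simp add: squares_def Let_def)

lemma squares_comp1_borders [simp]:
  "sq_top (q \<odot>\<^bsub>squares C\<^esub> p) = sq_top p"
  "sq_bot (q \<odot>\<^bsub>squares C\<^esub> p) = sq_bot q"
  "sq_left (q \<odot>\<^bsub>squares C\<^esub> p) = sq_left q \<odot>\<^bsub>C\<^esub> sq_left p"
  "sq_right (q \<odot>\<^bsub>squares C\<^esub> p) = sq_right q \<odot>\<^bsub>C\<^esub> sq_right p"
  by (simp_all flip: sq_comp_eq add: sq_comp_def)

lemma squares_whisker [simp]:
  "lwhisker (squares C) q p = comp1 (squares C) q p"
  "rwhisker (squares C) q p = comp1 (squares C) q p"
  by (simp_all add: lwhisker_def rwhisker_def sq_comp_eq)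

lemma Arr_squaresE:
  assumes "p \<in> Arr (squares C)"
  obtains f g u v \<phi> where "p = Square f g u v \<phi>" "f \<in> Arr C" "g \<in> Arr C"
    "u \<in> Arr C" "dom1 C u = dom1 C f" "cod1 C u = dom1 C g"
    "v \<in> Arr C" "dom1 C v = cod1 C f" "cod1 C v = cod1 C g"
    "\<phi> \<in> Cell C" "src2 C \<phi> = v \<odot>\<^bsub>C\<^esub> f" "tgt2 C \<phi> = g \<odot>\<^bsub>C\<^esub> u"
  using assms by (cases p) (auto simp: in_hom1_def in_hom2_def)

context two_category
begin

lemma squares_comp1_hom:
  assumes "p \<in> Arr (squares C)" "q \<in> Arr (squares C)" "sq_top q = sq_bot p"
  shows "q \<odot>\<^bsub>squares C\<^esub> p \<in> Arr (squares C)"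
  using assms by (auto elim!: Arr_squaresE simp: in_hom1_def in_hom2_def)

lemma squares_comp1_assoc:
  assumes "p \<in> Arr (squares C)" "q \<in> Arr (squares C)" "r \<in> Arr (squares C)"
    and "sq_top q = sq_bot p" "sq_top r = sq_bot q"
  shows "(r \<odot>\<^bsub>squares C\<^esub> q) \<odot>\<^bsub>squares C\<^esub> p = r \<odot>\<^bsub>squares C\<^esub> (q \<odot>\<^bsub>squares C\<^esub> p)"
  using assms by (auto elim!: Arr_squaresE)

theorem squares_two_category: "two_category (squares C)"
proof
  fix f assume "f \<in> Arr (squares C)"
  then show "dom1 (squares C) f \<in> Obj (squares C)" "cod1 (squares C) f \<in> Obj (squares C)"
    by (auto elim!: Arr_squaresE)
qed (auto simp: sq_comp_eq in_hom1_def[of "squares C"] in_hom2_def[of "squares C"]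
      squares_comp1_hom squares_comp1_assoc, auto elim!: Arr_squaresE simp: in_hom1_def in_hom2_def)

end

section \<open>Lifting 2-monads and distributive laws to squares\<close>

definition sq_map :: "('o, 'm, 'c, 'y) two_functor_data_scheme \<Rightarrow> ('m, 'c) square \<Rightarrow> ('m, 'c) square"
  where "sq_map F p = Square (on1 F (sq_top p)) (on1 F (sq_bot p))
    (on1 F (sq_left p)) (on1 F (sq_right p)) (on2 F (sq_cell p))"

text \<open>
  Naturality on 1-cells says that the two composites around the boundary of this square are equal,
  so it can be filled with an identity.
\<close>

definition sq_component ::
    "('o, 'm, 'c, 'z) two_cat_data_scheme \<Rightarrow> ('o, 'm, 'c, 'x) two_functor_data_scheme
      \<Rightarrow> ('o, 'm, 'c, 'y) two_functor_data_scheme \<Rightarrow> ('o \<Rightarrow> 'm) \<Rightarrow> 'm \<Rightarrow> ('m, 'c) square"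
  where "sq_component C F G \<theta> f = Square (on1 F f) (on1 G f) (\<theta> (dom1 C f)) (\<theta> (cod1 C f))
    (one2 C (\<theta> (cod1 C f) \<odot>\<^bsub>C\<^esub> on1 F f))"

definition sq_functor ::
    "('o, 'm, 'c, 'y) two_functor_data_scheme
      \<Rightarrow> ('m, ('m, 'c) square, ('m, 'c) square) two_functor_data"
  where "sq_functor F = \<lparr>on0 = on1 F, on1 = sq_map F, on2 = sq_map F\<rparr>"

definition sq_monad ::
    "('o, 'm, 'c, 'z) two_cat_data_scheme \<Rightarrow> ('o, 'm, 'c, 'y) two_monad_data_scheme
      \<Rightarrow> ('m, ('m, 'c) square, ('m, 'c) square) two_monad_data"
  where "sq_monad C R = \<lparr>on0 = on1 R, on1 = sq_map R, on2 = sq_map R,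
    unit = sq_component C id_functor R (unit R), mult = sq_component C (R \<circ>\<^sub>F R) R (mult R)\<rparr>"

lemma sq_map_Square [simp]:
  "sq_map F (Square f g u v \<phi>) = Square (on1 F f) (on1 F g) (on1 F u) (on1 F v) (on2 F \<phi>)"
  by (simp add: sq_map_def)

lemma sq_functor_simps [simp]:
  "on0 (sq_functor F) = on1 F" "on1 (sq_functor F) = sq_map F" "on2 (sq_functor F) = sq_map F"
  by (simp_all add: sq_functor_def)

lemma sq_monad_simps [simp]:
  "on0 (sq_monad C R) = on1 R" "on1 (sq_monad C R) = sq_map R" "on2 (sq_monad C R) = sq_map R"
  "unit (sq_monad C R) = sq_component C id_functor R (unit R)"
  "mult (sq_monad C R) = sq_component C (R \<circ>\<^sub>F R) R (mult R)"
  by (simp_all add: sq_monad_def)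

lemma (in two_functor) sq_functor_two_functor: "two_functor (squares C) (sq_functor F)"
proof -
  interpret Q: two_category "squares C" by (rule squares_two_category)
  show ?thesis
    by unfold_locales
      (auto elim!: Arr_squaresE simp: sq_comp_eq in_hom1_def in_hom2_def)
qed

text \<open>
  Naturality with respect to a square is the 2-dimensional half of 2-naturality, applied to the
  2-cell in the square.
\<close>

lemma (in two_natural) sq_component_two_natural:
  "two_natural (squares C) (sq_functor F) (sq_functor G) (sq_component C F G \<theta>)"
proof -
  interpret F: two_functor "squares C" "sq_functor F" by (rule dom.sq_functor_two_functor)
  interpret G: two_functor "squares C" "sq_functor G" by (rule cod.sq_functor_two_functor)
  have natural: "sq_component C F G \<theta> (sq_bot p) \<odot>\<^bsub>squares C\<^esub> sq_map F p =
      sq_map G p \<odot>\<^bsub>squares C\<^esub> sq_component C F G \<theta> (sq_top p)" if "p \<in> Arr (squares C)" for p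
    using that by (auto elim!: Arr_squaresE simp: sq_component_def naturality naturality2)
  show ?thesis
  proof unfold_locales
    fix f assume "f \<in> Obj (squares C)"
    then show "in_hom1 (squares C) (sq_component C F G \<theta> f) (on0 (sq_functor F) f) (on0 (sq_functor G) f)"
      by (simp add: in_hom1_def in_hom2_def sq_component_def naturality)
  qed (auto simp: in_hom1_def[of "squares C"] in_hom2_def[of "squares C"] natural)
qed

text \<open>
  The squares coming from units, multiplications and distributive laws are filled with identities.
  Such squares are closed under pasting and under 2-functors, and are determined by their
  boundary. An equation between parallel composites of them therefore holds as soon as it holds in \<open>C\<close> on
  the left and on the right edge; in this way the axioms of a monad or a distributive law pass
  from \<open>C\<close> to its squares.
\<close>

definition commuting :: "('o, 'm, 'c, 'z) two_cat_data_scheme \<Rightarrow> ('m, 'c) square \<Rightarrow> bool"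
  where "commuting C p \<longleftrightarrow> p \<in> Arr (squares C) \<and> sq_cell p = one2 C (sq_right p \<odot>\<^bsub>C\<^esub> sq_top p)"

lemma sq_map_borders [simp]:
  "sq_top (sq_map F p) = on1 F (sq_top p)"
  "sq_bot (sq_map F p) = on1 F (sq_bot p)"
  "sq_left (sq_map F p) = on1 F (sq_left p)"
  "sq_right (sq_map F p) = on1 F (sq_right p)"
  by (simp_all add: sq_map_def)

lemma sq_component_borders [simp]:
  "sq_top (sq_component C F G \<theta> f) = on1 F f"
  "sq_bot (sq_component C F G \<theta> f) = on1 G f"
  "sq_left (sq_component C F G \<theta> f) = \<theta> (dom1 C f)"
  "sq_right (sq_component C F G \<theta> f) = \<theta> (cod1 C f)"
  by (simp_all add: sq_component_def)

lemma commuting_eqI: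
  assumes "commuting C p" "commuting C q" "sq_top p = sq_top q" "sq_bot p = sq_bot q"
    "sq_left p = sq_left q" "sq_right p = sq_right q"
  shows "p = q"
  using assms by (simp add: commuting_def square.expand)

lemma (in two_category) commuting_one1:
  "\<lbrakk>f \<in> Arr C; dom1 C f = X; cod1 C f = Y\<rbrakk>
    \<Longrightarrow> commuting C (Square f f (one1 C X) (one1 C Y) (one2 C f))"
  by (auto simp: commuting_def in_hom1_def in_hom2_def)

lemma (in two_category) commutingE:
  assumes "commuting C p"
  obtains f g u v where "p = Square f g u v (one2 C (v \<odot> f))" "v \<odot> f = g \<odot> u"
    "f \<in> Arr C" "g \<in> Arr C" "u \<in> Arr C" "dom1 C u = dom1 C f" "cod1 C u = dom1 C g"
    "v \<in> Arr C" "dom1 C v = cod1 C f" "cod1 C v = cod1 C g"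
  using assms unfolding commuting_def by (auto elim!: Arr_squaresE)

lemma (in two_category) commuting_comp1:
  assumes "commuting C p" "commuting C q" "sq_top q = sq_bot p"
  shows "commuting C (q \<odot>\<^bsub>squares C\<^esub> p)"
proof -
  obtain f g u v where p: "p = Square f g u v (one2 C (v \<odot> f))" and vf: "v \<odot> f = g \<odot> u"
    and cells: "f \<in> Arr C" "g \<in> Arr C" "u \<in> Arr C" "dom1 C u = dom1 C f" "cod1 C u = dom1 C g"
      "v \<in> Arr C" "dom1 C v = cod1 C f" "cod1 C v = cod1 C g"
    using assms(1) by (rule commutingE)
  obtain g' u' v' where q: "q = Square g g' u' v' (one2 C (v' \<odot> g))" and vg: "v' \<odot> g = g' \<odot> u'"
    and cells': "g' \<in> Arr C" "u' \<in> Arr C" "dom1 C u' = dom1 C g" "cod1 C u' = dom1 C g'"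
      "v' \<in> Arr C" "dom1 C v' = cod1 C g" "cod1 C v' = cod1 C g'"
    using assms(2,3) p by (auto elim!: commutingE)
  have "v' \<odot> (g \<odot> u) = g' \<odot> (u' \<odot> u)"
    using comp1_tail[OF vg, of u] cells cells' by simp
  with p q vf cells cells' show ?thesis
    by (simp add: commuting_def in_hom1_def in_hom2_def)
qed

lemma (in two_functor) commuting_sq_map:
  assumes "commuting C p"
  shows "commuting C (sq_map F p)"
proof -
  obtain f g u v where p: "p = Square f g u v (one2 C (v \<odot> f))" and "v \<odot> f = g \<odot> u"
    and cells: "f \<in> Arr C" "g \<in> Arr C" "u \<in> Arr C" "dom1 C u = dom1 C f" "cod1 C u = dom1 C g"
      "v \<in> Arr C" "dom1 C v = cod1 C f" "cod1 C v = cod1 C g"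
    using assms by (rule commutingE)
  then have "on1 F v \<odot> on1 F f = on1 F g \<odot> on1 F u"
    using on1_comp1'[of f v] on1_comp1'[of u g] by simp
  with p cells show ?thesis
    by (simp add: commuting_def in_hom1_def in_hom2_def)
qed

lemma (in two_natural) commuting_sq_component:
  "f \<in> Arr C \<Longrightarrow> commuting C (sq_component C F G \<theta> f)"
  by (simp add: commuting_def sq_component_def in_hom1_def in_hom2_def naturality)

lemma (in two_monad) sq_monad_two_monad: "two_monad (squares C) (sq_monad C R)"
proof -
  have R_functor: "two_functor (squares C) (sq_monad C R)"
    using sq_functor_two_functor by (subst two_functor_cong[of _ "sq_functor R"]) simp_all
  have R_unit: "two_natural (squares C) id_functor (sq_monad C R) (unit (sq_monad C R))"
    using unit.sq_component_two_natural
    by (subst two_natural_cong[of _ "sq_functor id_functor" _ "sq_functor R"])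
      (auto simp: sq_map_def)
  have R_mult: "two_natural (squares C) (sq_monad C R \<circ>\<^sub>F sq_monad C R) (sq_monad C R) (mult (sq_monad C R))"
    using mult.sq_component_two_natural
    by (subst two_natural_cong[of _ "sq_functor (R \<circ>\<^sub>F R)" _ "sq_functor R"])
      (auto simp: sq_map_def comp_functor_def)
  show ?thesis
    by (intro two_monad.intro two_monad_axioms.intro R_functor R_unit R_mult; rule commuting_eqI[of C])
      (auto intro!: commuting_one1 commuting_comp1 commuting_sq_map unit.commuting_sq_component
        mult.commuting_sq_component simp: mult_assoc mult_unit_inner mult_unit_outer)
qed

lemma (in distributive_law) sq_distributive_law:
  "distributive_law (squares C) (sq_monad C S) (sq_monad C T)
    (sq_component C (S \<circ>\<^sub>F T) (T \<circ>\<^sub>F S) \<Lambda>)"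
proof -
  have nat: "two_natural (squares C) (sq_monad C S \<circ>\<^sub>F sq_monad C T) (sq_monad C T \<circ>\<^sub>F sq_monad C S)
      (sq_component C (S \<circ>\<^sub>F T) (T \<circ>\<^sub>F S) \<Lambda>)"
    using law.sq_component_two_natural
    by (subst two_natural_cong[of _ "sq_functor (S \<circ>\<^sub>F T)" _ "sq_functor (T \<circ>\<^sub>F S)"])
      (auto simp: sq_map_def comp_functor_def)
  show ?thesis
    by (intro distributive_law.intro distributive_law_axioms.intro nat
        S.sq_monad_two_monad T.sq_monad_two_monad; rule commuting_eqI[of C])
      (auto intro!: S.commuting_comp1 S.commuting_sq_map T.commuting_sq_map
        S.unit.commuting_sq_component S.mult.commuting_sq_component
        T.unit.commuting_sq_component T.mult.commuting_sq_component
        law.commuting_sq_component simp: law_unit_S law_unit_T law_mult_S law_mult_T)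
qed


section \<open>Weak maps as strict algebras in squares\<close>

text \<open>
  Written out, associativity of the action of a square on \<open>f\<close> is associativity of the actions on its
  two edges together with \<open>cell_mult\<close>, because the square of the multiplication contributes only an
  identity 2-cell; likewise unitality amounts to \<open>cell_unit\<close>.
\<close>

theorem weak_map_iff_strict_algebra:
  assumes "strict_algebra C R A a" "strict_algebra C R B b" "f :\<^bsub>C\<^esub> A \<rightarrow> B"
  shows "weak_map C R A a B b f \<rho> \<longleftrightarrow> invertible2 C \<rho> \<and>
    strict_algebra (squares C) (sq_monad C R) f (Square (on1 R f) f a b \<rho>)"
proof -
  interpret A: strict_algebra C R A a by fact
  interpret B: strict_algebra C R B b by fact
  interpret Q: two_monad "squares C" "sq_monad C R" by (rule A.sq_monad_two_monad)
  have f: "f \<in> Arr C" "dom1 C f = A" "cod1 C f = B"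
    using assms(3) by (auto simp: in_hom1_def)
  have \<rho>: "strict_algebra (squares C) (sq_monad C R) f (Square (on1 R f) f a b \<rho>) \<longleftrightarrow>
      in_hom2 C \<rho> (b \<odot>\<^bsub>C\<^esub> on1 R f) (f \<odot>\<^bsub>C\<^esub> a) \<and>
      (\<rho> \<lhd>\<^bsub>C\<^esub> on1 R a) \<bullet>\<^bsub>C\<^esub> (b \<rhd>\<^bsub>C\<^esub> on2 R \<rho>) = \<rho> \<lhd>\<^bsub>C\<^esub> mult R A \<and>
      \<rho> \<lhd>\<^bsub>C\<^esub> unit R A = one2 C f"
  proof (cases "in_hom2 C \<rho> (b \<odot>\<^bsub>C\<^esub> on1 R f) (f \<odot>\<^bsub>C\<^esub> a)")
    case True
    have unit: "b \<odot>\<^bsub>C\<^esub> unit R B = one1 C B" "a \<odot>\<^bsub>C\<^esub> unit R A = one1 C A"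
      by (rule A.action_unit B.action_unit)+
    have act: "a \<odot>\<^bsub>C\<^esub> on1 R a = a \<odot>\<^bsub>C\<^esub> mult R A" "b \<odot>\<^bsub>C\<^esub> on1 R b = b \<odot>\<^bsub>C\<^esub> mult R B"
      by (rule A.action_mult B.action_mult)+
    have nat: "unit R B \<odot>\<^bsub>C\<^esub> f = on1 R f \<odot>\<^bsub>C\<^esub> unit R A"
      "mult R B \<odot>\<^bsub>C\<^esub> on1 R (on1 R f) = on1 R f \<odot>\<^bsub>C\<^esub> mult R A"
      using A.unit.naturality[OF f] A.mult.naturality[OF f] by simp_all
    show ?thesis
      using True f Q.two_monad_axioms
      unfolding strict_algebra_def strict_algebra_axioms_def
      by (auto simp: in_hom1_def in_hom2_def sq_component_def unit act nat)
  next
    case False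
    then show ?thesis
      using f unfolding strict_algebra_def strict_algebra_axioms_def
      by (auto simp: in_hom1_def)
  qed
  show ?thesis
    unfolding \<rho> weak_map_def weak_map_axioms_def using assms by auto
qed

lemma strict_algebra_cong:
  assumes "two_monad C R" "two_monad C R'"
    and "on0 R = on0 R'" "on1 R = on1 R'"
    and "A \<in> Obj C \<Longrightarrow> unit R A = unit R' A" "A \<in> Obj C \<Longrightarrow> mult R A = mult R' A"
  shows "strict_algebra C R A a \<longleftrightarrow> strict_algebra C R' A a"
  using assms unfolding strict_algebra_def strict_algebra_axioms_def by auto

text \<open>
  Lifting the composite monad to squares and composing the lifted monads give units and
  multiplications that agree on 1-cells of \<open>C\<close> only: one is a single identity 2-cell, the other a
  pasting of identity 2-cells, and composition is unspecified outside the carriers. Algebras see no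
  difference.
\<close>

lemma (in distributive_law) sq_composite_strict_algebra_iff:
  "strict_algebra (squares C) (sq_monad C (composite_monad C S T \<Lambda>)) f h \<longleftrightarrow>
    strict_algebra (squares C) (composite_monad (squares C) (sq_monad C S) (sq_monad C T)
      (sq_component C (S \<circ>\<^sub>F T) (T \<circ>\<^sub>F S) \<Lambda>)) f h"
proof -
  interpret TS: two_monad C "composite_monad C S T \<Lambda>" by (rule composite_two_monad)
  note commuting_intros = S.commuting_comp1 S.commuting_sq_map T.commuting_sq_map
    S.unit.commuting_sq_component S.mult.commuting_sq_component
    T.unit.commuting_sq_component T.mult.commuting_sq_component
    TS.unit.commuting_sq_component TS.mult.commuting_sq_component
    law.commuting_sq_component
  show ?thesis
  proof (rule strict_algebra_cong)
    show "two_monad (squares C) (sq_monad C (composite_monad C S T \<Lambda>))"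
      by (rule TS.sq_monad_two_monad)
    show "two_monad (squares C) (composite_monad (squares C) (sq_monad C S) (sq_monad C T)
        (sq_component C (S \<circ>\<^sub>F T) (T \<circ>\<^sub>F S) \<Lambda>))"
      by (rule distributive_law.composite_two_monad[OF sq_distributive_law])
    show "on1 (sq_monad C (composite_monad C S T \<Lambda>)) = on1 (composite_monad (squares C)
        (sq_monad C S) (sq_monad C T) (sq_component C (S \<circ>\<^sub>F T) (T \<circ>\<^sub>F S) \<Lambda>))"
      by (auto simp: sq_map_def)
  qed (auto intro!: commuting_eqI[of C] commuting_intros)
qed


section \<open>Weak maps between distributive pairs\<close>

text \<open>
  The 1-cell \<open>f\<close> underlying a weak map is kept fixed: it is the object of the 2-category of squares
  on which the lifted monads act.
\<close>

locale distributive_pair_arrow = distributive_law C S T \<Lambda> +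
    A: distributive_pair C S T \<Lambda> A a\<^sub>t a\<^sub>s + B: distributive_pair C S T \<Lambda> B b\<^sub>t b\<^sub>s
  for C :: "('o, 'm, 'c, 'z) two_cat_data_scheme" (structure)
    and S :: "('o, 'm, 'c, 'x) two_monad_data_scheme"
    and T :: "('o, 'm, 'c, 'y) two_monad_data_scheme"
    and \<Lambda> :: "'o \<Rightarrow> 'm" and A :: 'o and a\<^sub>t :: 'm and a\<^sub>s :: 'm and B :: 'o and b\<^sub>t :: 'm and b\<^sub>s :: 'm +
  fixes f :: 'm
  assumes arrow: "f : A \<rightarrow> B"
begin

lemma arrow_simps [simp]: "f \<in> Arr C" "dom1 C f = A" "cod1 C f = B"
  using arrow by (simp_all add: in_hom1_def)

abbreviation "sq_S \<equiv> sq_monad C S"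
abbreviation "sq_T \<equiv> sq_monad C T"
abbreviation "sq_\<Lambda> \<equiv> sq_component C (S \<circ>\<^sub>F T) (T \<circ>\<^sub>F S) \<Lambda>"

sublocale Q: distributive_law "squares C" sq_S sq_T sq_\<Lambda>
  by (rule sq_distributive_law)

abbreviation "T_square \<tau> \<equiv> Square (on1 T f) f a\<^sub>t b\<^sub>t \<tau>"
abbreviation "S_square \<sigma> \<equiv> Square (on1 S f) f a\<^sub>s b\<^sub>s \<sigma>"
abbreviation "TS_square \<rho> \<equiv> Square (on1 T (on1 S f)) f (a\<^sub>t \<odot> on1 T a\<^sub>s) (b\<^sub>t \<odot> on1 T b\<^sub>s) \<rho>"

lemma weak_T_map_iff:
  "weak_map C T A a\<^sub>t B b\<^sub>t f \<tau> \<longleftrightarrow>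
    invertible2 C \<tau> \<and> strict_algebra (squares C) sq_T f (T_square \<tau>)"
  using A.T_alg.strict_algebra_axioms B.T_alg.strict_algebra_axioms arrow
  by (rule weak_map_iff_strict_algebra)

lemma weak_S_map_iff:
  "weak_map C S A a\<^sub>s B b\<^sub>s f \<sigma> \<longleftrightarrow>
    invertible2 C \<sigma> \<and> strict_algebra (squares C) sq_S f (S_square \<sigma>)"
  using A.S_alg.strict_algebra_axioms B.S_alg.strict_algebra_axioms arrow
  by (rule weak_map_iff_strict_algebra)

lemma weak_TS_map_iff:
  "weak_map C (composite_monad C S T \<Lambda>) A (a\<^sub>t \<odot> on1 T a\<^sub>s) B (b\<^sub>t \<odot> on1 T b\<^sub>s) f \<rho> \<longleftrightarrow>
    invertible2 C \<rho> \<and>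
    strict_algebra (squares C) (composite_monad (squares C) sq_S sq_T sq_\<Lambda>) f (TS_square \<rho>)"
  using weak_map_iff_strict_algebra[OF A.composite_strict_algebra B.composite_strict_algebra arrow]
  by (simp add: sq_composite_strict_algebra_iff)

text \<open>
  The interaction axiom is the compatibility condition of a distributive pair, read off from the
  2-cells of the two pasted squares.
\<close>

lemma distributive_pair_squares_iff:
  "distributive_pair (squares C) sq_S sq_T sq_\<Lambda> f (T_square \<tau>) (S_square \<sigma>) \<longleftrightarrow>
    strict_algebra (squares C) sq_T f (T_square \<tau>) \<and> strict_algebra (squares C) sq_S f (S_square \<sigma>) \<and>
    (\<tau> \<lhd> (on1 T a\<^sub>s \<odot> \<Lambda> A)) \<bullet> (b\<^sub>t \<rhd> on2 T \<sigma> \<lhd> \<Lambda> A) = (\<sigma> \<lhd> on1 S a\<^sub>t) \<bullet> (b\<^sub>s \<rhd> on2 S \<tau>)"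
proof (cases "\<tau> \<in> Cell C \<and> src2 C \<tau> = b\<^sub>t \<odot> on1 T f \<and> tgt2 C \<tau> = f \<odot> a\<^sub>t \<and>
    \<sigma> \<in> Cell C \<and> src2 C \<sigma> = b\<^sub>s \<odot> on1 S f \<and> tgt2 C \<sigma> = f \<odot> a\<^sub>s")
  case True
  have "\<Lambda> B \<odot> on1 S (on1 T f) = on1 T (on1 S f) \<odot> \<Lambda> A"
    using law.naturality[of f A B] by simp
  then have "S_square \<sigma> \<odot>\<^bsub>squares C\<^esub> on1 sq_S (T_square \<tau>) =
      T_square \<tau> \<odot>\<^bsub>squares C\<^esub> on1 sq_T (S_square \<sigma>) \<odot>\<^bsub>squares C\<^esub> sq_\<Lambda> f \<longleftrightarrow>
    (\<tau> \<lhd> (on1 T a\<^sub>s \<odot> \<Lambda> A)) \<bullet> (b\<^sub>t \<rhd> on2 T \<sigma> \<lhd> \<Lambda> A) = (\<sigma> \<lhd> on1 S a\<^sub>t) \<bullet> (b\<^sub>s \<rhd> on2 S \<tau>)"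
    using True A.pair_compatible B.pair_compatible by (auto simp: sq_component_def)
  then show ?thesis
    by (simp add: distributive_pair_def distributive_pair_axioms_def Q.distributive_law_axioms)
next
  case False
  then have "\<not> (strict_algebra (squares C) sq_T f (T_square \<tau>) \<and>
      strict_algebra (squares C) sq_S f (S_square \<sigma>))"
    using arrow_simps unfolding strict_algebra_def strict_algebra_axioms_def
    by (auto simp: in_hom1_def in_hom2_def)
  then show ?thesis
    by (auto simp: distributive_pair_def)
qed

lemma T_square_comp_S_square:
  "T_square \<tau> \<odot>\<^bsub>squares C\<^esub> on1 sq_T (S_square \<sigma>) =
    TS_square ((\<tau> \<lhd> on1 T a\<^sub>s) \<bullet> (b\<^sub>t \<rhd> on2 T \<sigma>))"
  by simp

text \<open>
  Pasting with the square of a unit whiskers \<open>\<rho>\<close> by that unit, so the operation that splits a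
  composite algebra in squares is the operation that restricts \<open>\<rho>\<close> along the units.
\<close>

lemma TS_square_components:
  assumes "\<rho> : (b\<^sub>t \<odot> on1 T b\<^sub>s) \<odot> on1 T (on1 S f) \<rightharpoonup> f \<odot> (a\<^sub>t \<odot> on1 T a\<^sub>s)"
  shows "TS_square \<rho> \<odot>\<^bsub>squares C\<^esub> on1 sq_T (unit sq_S f) = T_square (\<rho> \<lhd> on1 T (unit S A))"
    and "TS_square \<rho> \<odot>\<^bsub>squares C\<^esub> unit sq_T (on0 sq_S f) = S_square (\<rho> \<lhd> unit T (on0 S A))"
proof -
  have \<rho>: "\<rho> \<in> Cell C" "src2 C \<rho> = b\<^sub>t \<odot> on1 T b\<^sub>s \<odot> on1 T (on1 S f)"
    using assms by (simp_all add: in_hom2_def)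
  have "on1 T (unit S B) \<odot> on1 T f = on1 T (on1 S f) \<odot> on1 T (unit S A)"
    using arg_cong[where f = "on1 T", OF S.unit.naturality[of f, OF _ refl refl]] by simp
  then show "TS_square \<rho> \<odot>\<^bsub>squares C\<^esub> on1 sq_T (unit sq_S f) = T_square (\<rho> \<lhd> on1 T (unit S A))"
    using \<rho> A.composite_action_components B.composite_action_components
    by (simp add: sq_component_def)
  have "unit T (on0 S B) \<odot> on1 S f = on1 T (on1 S f) \<odot> unit T (on0 S A)"
    using T.unit.naturality[of "on1 S f"] by simp
  then show "TS_square \<rho> \<odot>\<^bsub>squares C\<^esub> unit sq_T (on0 sq_S f) = S_square (\<rho> \<lhd> unit T (on0 S A))"
    using \<rho> A.composite_action_components B.composite_action_components
    by (simp add: sq_component_def)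
qed

text \<open>
  Beck's theorem splits the algebra \<open>TS_square \<rho>\<close> into a distributive pair and recomposes it; on
  2-cells the recomposition is the formula for \<open>\<rho>\<close>.
\<close>

theorem weak_TS_map_components:
  assumes "weak_map C (composite_monad C S T \<Lambda>) A (a\<^sub>t \<odot> on1 T a\<^sub>s) B (b\<^sub>t \<odot> on1 T b\<^sub>s) f \<rho>"
  defines "\<tau> \<equiv> \<rho> \<lhd> on1 T (unit S A)" and "\<sigma> \<equiv> \<rho> \<lhd> unit T (on0 S A)"
  shows "weak_map C T A a\<^sub>t B b\<^sub>t f \<tau>" and "weak_map C S A a\<^sub>s B b\<^sub>s f \<sigma>"
    and "(\<tau> \<lhd> (on1 T a\<^sub>s \<odot> \<Lambda> A)) \<bullet> (b\<^sub>t \<rhd> on2 T \<sigma> \<lhd> \<Lambda> A) = (\<sigma> \<lhd> on1 S a\<^sub>t) \<bullet> (b\<^sub>s \<rhd> on2 S \<tau>)"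
    and "\<rho> = (\<tau> \<lhd> on1 T a\<^sub>s) \<bullet> (b\<^sub>t \<rhd> on2 T \<sigma>)"
proof -
  have inv: "invertible2 C \<rho>"
    and alg: "strict_algebra (squares C) (composite_monad (squares C) sq_S sq_T sq_\<Lambda>) f (TS_square \<rho>)"
    using assms(1) by (simp_all add: weak_TS_map_iff)
  have \<rho>: "\<rho> : (b\<^sub>t \<odot> on1 T b\<^sub>s) \<odot> on1 T (on1 S f) \<rightharpoonup> f \<odot> (a\<^sub>t \<odot> on1 T a\<^sub>s)"
    using weak_map.cell[OF assms(1)] by simp
  note comps = TS_square_components[OF \<rho>, folded \<tau>_def \<sigma>_def]
  have "invertible2 C \<tau>" "invertible2 C \<sigma>"
    unfolding \<tau>_def \<sigma>_def using inv \<rho>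
    by (auto intro!: S.invertible2_rwhisker simp: in_hom2_def)
  moreover have "distributive_pair (squares C) sq_S sq_T sq_\<Lambda> f (T_square \<tau>) (S_square \<sigma>)"
    using Q.composite_algebra_components(1)[OF alg] unfolding comps .
  ultimately show "weak_map C T A a\<^sub>t B b\<^sub>t f \<tau>" "weak_map C S A a\<^sub>s B b\<^sub>s f \<sigma>"
    "(\<tau> \<lhd> (on1 T a\<^sub>s \<odot> \<Lambda> A)) \<bullet> (b\<^sub>t \<rhd> on2 T \<sigma> \<lhd> \<Lambda> A) = (\<sigma> \<lhd> on1 S a\<^sub>t) \<bullet> (b\<^sub>s \<rhd> on2 S \<tau>)"
    unfolding distributive_pair_squares_iff weak_T_map_iff weak_S_map_iff by blast+
  have "TS_square \<rho> = T_square \<tau> \<odot>\<^bsub>squares C\<^esub> on1 sq_T (S_square \<sigma>)"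
    using Q.composite_algebra_components(2)[OF alg] unfolding comps .
  then show "\<rho> = (\<tau> \<lhd> on1 T a\<^sub>s) \<bullet> (b\<^sub>t \<rhd> on2 T \<sigma>)"
    unfolding T_square_comp_S_square by simp
qed

theorem weak_TS_map_of_components:
  assumes "weak_map C T A a\<^sub>t B b\<^sub>t f \<tau>" and "weak_map C S A a\<^sub>s B b\<^sub>s f \<sigma>"
    and "(\<tau> \<lhd> (on1 T a\<^sub>s \<odot> \<Lambda> A)) \<bullet> (b\<^sub>t \<rhd> on2 T \<sigma> \<lhd> \<Lambda> A) = (\<sigma> \<lhd> on1 S a\<^sub>t) \<bullet> (b\<^sub>s \<rhd> on2 S \<tau>)"
  defines "\<rho> \<equiv> (\<tau> \<lhd> on1 T a\<^sub>s) \<bullet> (b\<^sub>t \<rhd> on2 T \<sigma>)"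
  shows "weak_map C (composite_monad C S T \<Lambda>) A (a\<^sub>t \<odot> on1 T a\<^sub>s) B (b\<^sub>t \<odot> on1 T b\<^sub>s) f \<rho>"
    and "\<rho> \<lhd> on1 T (unit S A) = \<tau>" and "\<rho> \<lhd> unit T (on0 S A) = \<sigma>"
proof -
  have inv: "invertible2 C \<tau>" "invertible2 C \<sigma>"
    and \<tau>: "\<tau> \<in> Cell C" "src2 C \<tau> = b\<^sub>t \<odot> on1 T f" "tgt2 C \<tau> = f \<odot> a\<^sub>t"
    and \<sigma>: "\<sigma> \<in> Cell C" "src2 C \<sigma> = b\<^sub>s \<odot> on1 S f" "tgt2 C \<sigma> = f \<odot> a\<^sub>s"
    using weak_map.invertible[OF assms(1)] weak_map.invertible[OF assms(2)]
      weak_map.cell[OF assms(1)] weak_map.cell[OF assms(2)] by (simp_all add: in_hom2_def)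
  interpret pair: distributive_pair "squares C" sq_S sq_T sq_\<Lambda> f "T_square \<tau>" "S_square \<sigma>"
    using assms(1-3) by (simp add: distributive_pair_squares_iff weak_T_map_iff weak_S_map_iff)
  have comp: "T_square \<tau> \<odot>\<^bsub>squares C\<^esub> on1 sq_T (S_square \<sigma>) = TS_square \<rho>"
    unfolding \<rho>_def by (rule T_square_comp_S_square)
  have "invertible2 C \<rho>"
    unfolding \<rho>_def using inv \<tau> \<sigma>
    by (intro S.invertible2_vcomp S.invertible2_rwhisker S.invertible2_lwhisker T.on2_invertible2)
      simp_all
  then show weak: "weak_map C (composite_monad C S T \<Lambda>) A (a\<^sub>t \<odot> on1 T a\<^sub>s) B (b\<^sub>t \<odot> on1 T b\<^sub>s) f \<rho>"
    using pair.composite_strict_algebra unfolding comp weak_TS_map_iff by simp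
  have \<rho>: "\<rho> : (b\<^sub>t \<odot> on1 T b\<^sub>s) \<odot> on1 T (on1 S f) \<rightharpoonup> f \<odot> (a\<^sub>t \<odot> on1 T a\<^sub>s)"
    using weak_map.cell[OF weak] by simp
  show "\<rho> \<lhd> on1 T (unit S A) = \<tau>" "\<rho> \<lhd> unit T (on0 S A) = \<sigma>"
    using pair.composite_action_components unfolding comp TS_square_components[OF \<rho>] by simp_all
qed

end

theorem theorem2p9:
  fixes C :: "('o, 'm, 'c, 'z) two_cat_data_scheme" (structure)
    and S :: "('o, 'm, 'c, 'x) two_monad_data_scheme"
    and T :: "('o, 'm, 'c, 'y) two_monad_data_scheme"
    and \<Lambda> :: "'o \<Rightarrow> 'm"
  assumes "two_category C"
    and "two_monad C S"
    and "two_monad C T"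
    and "distributive_law C S T \<Lambda>"
    and "distributive_pair C S T \<Lambda> A a\<^sub>t a\<^sub>s"
    and "distributive_pair C S T \<Lambda> B b\<^sub>t b\<^sub>s"
  shows "bij_betw
      (\<lambda>(f, \<rho>). (f, \<rho> \<lhd> on1 T (unit S A), \<rho> \<lhd> unit T (on0 S A)))
      {(f, \<rho>). weak_map C (composite_monad C S T \<Lambda>)
                 A (a\<^sub>t \<odot> on1 T a\<^sub>s) B (b\<^sub>t \<odot> on1 T b\<^sub>s) f \<rho>}
      {(f, \<tau>, \<sigma>). weak_map C T A a\<^sub>t B b\<^sub>t f \<tau> \<and> weak_map C S A a\<^sub>s B b\<^sub>s f \<sigma> \<and>
         (\<tau> \<lhd> (on1 T a\<^sub>s \<odot> \<Lambda> A)) \<bullet> (b\<^sub>t \<rhd> on2 T \<sigma> \<lhd> \<Lambda> A) = (\<sigma> \<lhd> on1 S a\<^sub>t) \<bullet> (b\<^sub>s \<rhd> on2 S \<tau>)}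
    \<and> (\<forall>f \<rho>. weak_map C (composite_monad C S T \<Lambda>)
                 A (a\<^sub>t \<odot> on1 T a\<^sub>s) B (b\<^sub>t \<odot> on1 T b\<^sub>s) f \<rho> \<longrightarrow>
         \<rho> = (\<rho> \<lhd> on1 T (unit S A) \<lhd> on1 T a\<^sub>s) \<bullet> (b\<^sub>t \<rhd> on2 T (\<rho> \<lhd> unit T (on0 S A))))"
    (is "bij_betw ?components ?weak ?pairs \<and> ?formula")
proof -
  have arrow: "distributive_pair_arrow C S T \<Lambda> A a\<^sub>t a\<^sub>s B b\<^sub>t b\<^sub>s f" if "f : A \<rightarrow> B" for f
    using assms that by (intro distributive_pair_arrow.intro distributive_pair_arrow_axioms.intro)
  note split = distributive_pair_arrow.weak_TS_map_components[OF arrow[OF weak_map.arrow]]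
  note join = distributive_pair_arrow.weak_TS_map_of_components[OF arrow[OF weak_map.arrow]]
  have "bij_betw ?components ?weak ?pairs"
  proof (rule bij_betw_byWitness[where f' =
        "\<lambda>(f, \<tau>, \<sigma>). (f, (\<tau> \<lhd> on1 T a\<^sub>s) \<bullet> (b\<^sub>t \<rhd> on2 T \<sigma>))"])
    show "\<forall>p\<in>?weak. (\<lambda>(f, \<tau>, \<sigma>). (f, (\<tau> \<lhd> on1 T a\<^sub>s) \<bullet> (b\<^sub>t \<rhd> on2 T \<sigma>)))
        (?components p) = p"
      by (auto simp flip: split(4))
    show "\<forall>q\<in>?pairs. ?components
        ((\<lambda>(f, \<tau>, \<sigma>). (f, (\<tau> \<lhd> on1 T a\<^sub>s) \<bullet> (b\<^sub>t \<rhd> on2 T \<sigma>))) q) = q"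
      by (auto simp: join(2,3))
    show "?components ` ?weak \<subseteq> ?pairs"
      by (auto simp: split(1-3))
    show "(\<lambda>(f, \<tau>, \<sigma>). (f, (\<tau> \<lhd> on1 T a\<^sub>s) \<bullet> (b\<^sub>t \<rhd> on2 T \<sigma>))) ` ?pairs \<subseteq> ?weak"
      by (auto simp: join(1))
  qed
  moreover have ?formula
    using split(4) by blast
  ultimately show ?thesis ..
qed

end
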